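(* Let $p$ be an odd prime, $r\ge 1$, $q>r$, and let $\alpha,\beta\ge0$ be integers with $\alpha+\beta=q-r$. For $u,v\in R_q$ and $\lambda\in R_q^\times$ write $$M=M(v,u,\lambda)=\begin{pmatrix}\lambda&u\\ p^rv&1\end{pmatrix},\qquad X(c,s)=\begin{pmatrix}1&s\\ p^rc&1\end{pmatrix}.$$ The normalizer of $\mathsf W_{\alpha,\beta}$ inside $\mathfrak M_{p;r,q}$ is exactly $$\mathsf N_{\alpha,\beta}=\{M(v,u,\lambda): v\in p^\alpha R_q,\ u\in p^\beta R_q,\ \lambda\in R_q^\times\},$$ and it has order $|\mathsf N_{\alpha,\beta}|=p^{q+r}\varphi(p^q)$. With $\Delta=\lambda-p^ruv$ one has exactly $$MX(c,s)M^{-1}=I+\Delta^{-1}\begin{pmatrix}A&B\\ C&-A\end{pmatrix},$$ where $$A=p^r(uc-\lambda vs),\qquad B=\lambda^2s-p^ru^2c,\qquad C=p^r(c-p^rv^2s).$$ For $M\in\mathsf N_{\alpha,\beta}$ and $X(c,s)\in\mathsf W_{\alpha,\beta}$ this reduces to $$MX(c,s)M^{-1}=X(\lambda^{-1}c,\lambda s).$$ Consequently the subgroups $\mathsf W_{\alpha,\beta}$ for distinct pairs $(\alpha,\beta)$ with $\alpha,\beta\ge0$, $\alpha+\beta=q-r$ are pairwise nonconjugate inside $\mathfrak M_{p;r,q}$, and $$\mathsf N_{\alpha,\beta}/\mathsf W_{\alpha,\beta}\cong R_q^\times .$$ On the perfect residual pairing $\overline A_\alpha\times\overline B_\beta\to\mu_{p^r}$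 this quotient acts by $(x,y)\mapsto(\lambda^{-1}x,\lambda y)$, so the effective action factors through $(\mathbf Z/p^r\mathbf Z)^\times$, with kernel $1+p^rR_q$.
   Context: $\mathbf Z_p$ is the ring of $p$-adic integers, $R_q=\mathbf Z/p^q\mathbf Z$, $\varphi$ is Euler's totient function, $\mu_m$ is the group of complex $m$-th roots of unity. $\mathfrak M_{p;r,q}$ is the projective monomial automorphism group of the matrix $H_{p;r,q}(a,b)=\chi(1+p^rab)$ on $R_q$ ($\chi$ a faithful character of the cyclic group $(1+p^r\mathbf Z_p)/(1+p^{q+r}\mathbf Z_p)$). Its elements are in unique bijection with triples $(c,s,\lambda)\in R_q\times R_q\times R_q^\times$ (the automorphism with column permutation $b\mapsto(s+\lambda b)/(1+p^rcb)$ and row permutation $a\mapsto(c+\lambda a)/(1+p^rsa)$). Here the triple is represented projectively by the matrix $\begin{pmatrix}\lambda&s\\ p^rc&1\end{pmatrix}$, so $M(v,u,\lambda)$ is the element with triple $(v,u,\lambda)$. The group law is matrix multiplication up to unit scalars, normalized so that the lower-right entry is $1$; the upper entries and diagonal are taken modulo $p^q$, and the lower-left entry is recorded as $p^rc$ with $c\in R_q$ (i.e. $c$ modulo $p^q$ is retained). Explicitly, $M(v,u,\lambda)M(v',u',\lambda')=M\!\left(\frac{v\lambda'+v'}{w},\frac{\lambda u'+u}{w},\frac{\lambda\lambda'+p^ruv'}{w}\right)$ with $w=1+p^rvu'$. (Using the opposite order of multiplication gives an isomorphic group and the same subgroups and normalizers.) For $\alpha,\beta\ge0$ with $\alpha+\beta=q-r$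 (a "maximal polarization"), the projective window is the subgroup $\mathsf W_{\alpha,\beta}=\{[X(c,s)]: c\in p^\alpha R_q,\ s\in p^\beta R_q\}$ of $\mathfrak M_{p;r,q}$; it has order $p^{q+r}$. The residual groups are $\overline A_\alpha=p^\alpha R_q/p^{\alpha+r}R_q$ and $\overline B_\beta=p^\beta R_q/p^{\beta+r}R_q$, both cyclic of order $p^r$, with coordinates $x,y\in\mathbf Z/p^r\mathbf Z$ given by $c=p^\alpha x$, $s=p^\beta y$. The residual pairing is induced by $(c,s)\mapsto\chi(1+p^rcs)$ and equals $\exp(2\pi i\kappa xy/p^r)$ for a unit $\kappa\in R_q^\times$ depending only on $\chi$. The quotient $\mathsf N_{\alpha,\beta}/\mathsf W_{\alpha,\beta}$ acts on the residual groups through conjugation on the parameters $(c,s)$ of $\mathsf W_{\alpha,\beta}$, and is identified with $R_q^\times$ via $M(v,u,\lambda)\mapsto\lambda$. *)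

theory Defs
  imports
    "HOL-Algebra.Group_Action"
    "HOL-Number_Theory.Number_Theory"
    "Jordan_Normal_Form.Matrix"
begin

section \<open>The rings and the character\<close>

text \<open>
  The ring \<open>Z/p^qZ\<close> is the library's \<^const>\<open>residue_ring\<close>, with least nonnegative residues as
  elements.  All functions below that take integer arguments standing for elements of \<open>Z/p^qZ\<close>
  depend only on the classes of these arguments modulo \<open>p^q\<close> (and, where a unit is expected, are
  only meaningful for integers prime to \<open>p\<close>).
\<close>

abbreviation Rq :: "nat \<Rightarrow> nat \<Rightarrow> int ring" where
  "Rq p q \<equiv> residue_ring (int p ^ q)"

definition ppow_ideal :: "nat \<Rightarrow> nat \<Rightarrow> nat \<Rightarrow> int set" where
  "ppow_ideal p q k = {(int p ^ k * y) mod int p ^ q | y. y \<in> carrier (Rq p q)}"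

text \<open>
  The group \<open>(1 + p^r Z\<^sub>p) / (1 + p^(q+r) Z\<^sub>p)\<close>, realized as the subgroup of the residues congruent
  to \<open>1\<close> modulo \<open>p^r\<close> in the unit group of \<open>Z\<^sub>p/p^(q+r)Z\<^sub>p = Z/p^(q+r)Z\<close>.
\<close>

definition principal_units :: "nat \<Rightarrow> nat \<Rightarrow> nat \<Rightarrow> int monoid" where
  "principal_units p r q =
     (units_of (Rq p (q + r))) \<lparr>carrier := {x \<in> Units (Rq p (q + r)). [x = 1] (mod int p ^ r)}\<rparr>"

definition complex_mult_on :: "complex set \<Rightarrow> complex monoid" where
  "complex_mult_on S = \<lparr>carrier = S, monoid.mult = (*), one = 1\<rparr>"

definition mu :: "nat \<Rightarrow> complex monoid" where
  "mu m = complex_mult_on {z. z ^ m = 1}"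

definition faithful_character :: "nat \<Rightarrow> nat \<Rightarrow> nat \<Rightarrow> (int \<Rightarrow> complex) \<Rightarrow> bool" where
  "faithful_character p r q \<chi> \<longleftrightarrow>
     \<chi> \<in> hom (principal_units p r q) (complex_mult_on (- {0})) \<and>
     inj_on \<chi> (carrier (principal_units p r q))"

text \<open>\<open>\<chi>(1 + p^r t)\<close>, which depends only on \<open>t\<close> modulo \<open>p^q\<close>.\<close>

definition chi1 :: "nat \<Rightarrow> nat \<Rightarrow> nat \<Rightarrow> (int \<Rightarrow> complex) \<Rightarrow> int \<Rightarrow> complex" where
  "chi1 p r q \<chi> t = \<chi> ((1 + int p ^ r * t) mod int p ^ (q + r))"

section \<open>The projective monomial automorphism group\<close>

definition H_mat :: "nat \<Rightarrow> nat \<Rightarrow> nat \<Rightarrow> (int \<Rightarrow> complex) \<Rightarrow> complex mat" where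
  "H_mat p r q \<chi> = mat (p ^ q) (p ^ q) (\<lambda>(a, b). chi1 p r q \<chi> (int a * int b))"

definition monomial_mat :: "nat \<Rightarrow> complex mat \<Rightarrow> bool" where
  "monomial_mat n P \<longleftrightarrow> P \<in> carrier_mat n n \<and>
     (\<forall>i<n. \<exists>!j. j < n \<and> P $$ (i, j) \<noteq> 0) \<and>
     (\<forall>j<n. \<exists>!i. i < n \<and> P $$ (i, j) \<noteq> 0)"

text \<open>A monomial automorphism of \<open>H\<close> is a pair \<open>(P, Q)\<close> of monomial matrices with \<open>P H Q\<inverse> = H\<close>.\<close>

definition monomial_aut :: "nat \<Rightarrow> complex mat \<Rightarrow> (complex mat \<times> complex mat) monoid" where
  "monomial_aut n H =
     \<lparr>carrier = {(P, Q). monomial_mat n P \<and> monomial_mat n Q \<and> P * H = H * Q},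
      monoid.mult = \<lambda>(P, Q) (P', Q'). (P * P', Q * Q'),
      one = (1\<^sub>m n, 1\<^sub>m n)\<rparr>"

definition scalar_pairs :: "nat \<Rightarrow> (complex mat \<times> complex mat) set" where
  "scalar_pairs n = {(z \<cdot>\<^sub>m 1\<^sub>m n, z \<cdot>\<^sub>m 1\<^sub>m n) | z. z \<noteq> 0}"

definition proj_aut ::
    "nat \<Rightarrow> nat \<Rightarrow> nat \<Rightarrow> (int \<Rightarrow> complex) \<Rightarrow> (complex mat \<times> complex mat) set monoid" where
  "proj_aut p r q \<chi> = monomial_aut (p ^ q) (H_mat p r q \<chi>) Mod scalar_pairs (p ^ q)"

text \<open>
  The element with triple \<open>(v, u, l)\<close>: the column permutation is
  \<open>b \<mapsto> (u + l b) / (1 + p^r v b)\<close> and the row permutation is \<open>a \<mapsto> (v + l a) / (1 + p^r u a)\<close>.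
  The phases come from the identity
  \<open>(1 + p^r a' b) (1 + p^r u a) = (1 + p^r a b') (1 + p^r v b)\<close> for the images \<open>a'\<close> of \<open>a\<close> and
  \<open>b'\<close> of \<open>b\<close>.  A column permutation \<open>\<tau>\<close> is encoded by nonzero entries at \<open>(\<tau> b, b)\<close> and a row
  permutation \<open>\<sigma>\<close> by nonzero entries at \<open>(a, \<sigma> a)\<close>; with this convention multiplication in
  \<^const>\<open>proj_aut\<close> is multiplication of the projective matrices \<open>(l, u; p^r v, 1)\<close>.
\<close>

definition col_perm :: "nat \<Rightarrow> nat \<Rightarrow> nat \<Rightarrow> int \<Rightarrow> int \<Rightarrow> int \<Rightarrow> nat \<Rightarrow> nat" where
  "col_perm p r q v u l b =
     nat (((u + l * int b) * modular_inverse (int p ^ q) (1 + int p ^ r * v * int b)) mod int p ^ q)"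

definition row_perm :: "nat \<Rightarrow> nat \<Rightarrow> nat \<Rightarrow> int \<Rightarrow> int \<Rightarrow> int \<Rightarrow> nat \<Rightarrow> nat" where
  "row_perm p r q v u l a =
     nat (((v + l * int a) * modular_inverse (int p ^ q) (1 + int p ^ r * u * int a)) mod int p ^ q)"

definition M_elt ::
    "nat \<Rightarrow> nat \<Rightarrow> nat \<Rightarrow> (int \<Rightarrow> complex) \<Rightarrow> int \<Rightarrow> int \<Rightarrow> int \<Rightarrow> (complex mat \<times> complex mat) set" where
  "M_elt p r q \<chi> v u l =
     scalar_pairs (p ^ q) #>\<^bsub>monomial_aut (p ^ q) (H_mat p r q \<chi>)\<^esub>
       (mat (p ^ q) (p ^ q)
          (\<lambda>(a, a'). if a' = row_perm p r q v u l a then chi1 p r q \<chi> (u * int a) else 0),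
        mat (p ^ q) (p ^ q)
          (\<lambda>(b', b). if b' = col_perm p r q v u l b then chi1 p r q \<chi> (v * int b) else 0))"

definition X_elt ::
    "nat \<Rightarrow> nat \<Rightarrow> nat \<Rightarrow> (int \<Rightarrow> complex) \<Rightarrow> int \<Rightarrow> int \<Rightarrow> (complex mat \<times> complex mat) set" where
  "X_elt p r q \<chi> c s = M_elt p r q \<chi> c s 1"

section \<open>Representing matrices\<close>

definition mat2 :: "int \<Rightarrow> int \<Rightarrow> int \<Rightarrow> int \<Rightarrow> int mat" where
  "mat2 a b c d = mat_of_rows_list 2 [[a, b], [c, d]]"

definition M_mat :: "nat \<Rightarrow> nat \<Rightarrow> int \<Rightarrow> int \<Rightarrow> int \<Rightarrow> int mat" where
  "M_mat p r v u l = mat2 l u (int p ^ r * v) 1"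

definition X_mat :: "nat \<Rightarrow> nat \<Rightarrow> int \<Rightarrow> int \<Rightarrow> int mat" where
  "X_mat p r c s = mat2 1 s (int p ^ r * c) 1"

text \<open>
  Equality of matrices over the integers whose upper and diagonal entries are taken modulo \<open>p^q\<close>,
  while the lower left entry is \<open>p^r c\<close> with \<open>c\<close> taken modulo \<open>p^q\<close>, i.e. is taken modulo
  \<open>p^(q+r)\<close>.  On matrices with lower left entry divisible by \<open>p^r\<close> it is compatible with
  matrix multiplication.
\<close>

definition mat_cong :: "nat \<Rightarrow> nat \<Rightarrow> nat \<Rightarrow> int mat \<Rightarrow> int mat \<Rightarrow> bool" where
  "mat_cong p r q A B \<longleftrightarrow>
     [A $$ (0, 0) = B $$ (0, 0)] (mod int p ^ q) \<and>
     [A $$ (0, 1) = B $$ (0, 1)] (mod int p ^ q) \<and>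
     [A $$ (1, 0) = B $$ (1, 0)] (mod int p ^ (q + r)) \<and>
     [A $$ (1, 1) = B $$ (1, 1)] (mod int p ^ q)"

text \<open>
  The element represented projectively by a matrix with unit diagonal and lower left entry
  divisible by \<open>p^r\<close>, obtained by normalizing the lower right entry to \<open>1\<close>.
\<close>

definition proj_elt ::
    "nat \<Rightarrow> nat \<Rightarrow> nat \<Rightarrow> (int \<Rightarrow> complex) \<Rightarrow> int mat \<Rightarrow> (complex mat \<times> complex mat) set" where
  "proj_elt p r q \<chi> A =
     (let e = modular_inverse (int p ^ q) (A $$ (1, 1))
      in M_elt p r q \<chi> ((A $$ (1, 0) div int p ^ r) * e) (A $$ (0, 1) * e) (A $$ (0, 0) * e))"

section \<open>Windows, residual groups and the residual action\<close>

definition window ::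
    "nat \<Rightarrow> nat \<Rightarrow> nat \<Rightarrow> (int \<Rightarrow> complex) \<Rightarrow> nat \<Rightarrow> nat \<Rightarrow> (complex mat \<times> complex mat) set set" where
  "window p r q \<chi> \<alpha> \<beta> =
     {X_elt p r q \<chi> c s | c s. c \<in> ppow_ideal p q \<alpha> \<and> s \<in> ppow_ideal p q \<beta>}"

text \<open>The additive group \<open>p^k R\<^sub>q / p^(k+r) R\<^sub>q\<close>, and its element with coordinate \<open>x\<close>.\<close>

definition resid :: "nat \<Rightarrow> nat \<Rightarrow> nat \<Rightarrow> nat \<Rightarrow> int set monoid" where
  "resid p r q k =
     (add_monoid (Rq p q)) \<lparr>carrier := ppow_ideal p q k\<rparr> Mod ppow_ideal p q (k + r)"

definition resid_pt :: "nat \<Rightarrow> nat \<Rightarrow> nat \<Rightarrow> nat \<Rightarrow> int \<Rightarrow> int set" where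
  "resid_pt p r q k x =
     ppow_ideal p q (k + r) #>\<^bsub>add_monoid (Rq p q)\<^esub> ((int p ^ k * x) mod int p ^ q)"

definition resid_pairing ::
    "nat \<Rightarrow> nat \<Rightarrow> nat \<Rightarrow> (int \<Rightarrow> complex) \<Rightarrow> int set \<Rightarrow> int set \<Rightarrow> complex" where
  "resid_pairing p r q \<chi> C S = (THE z. \<forall>c\<in>C. \<forall>s\<in>S. z = chi1 p r q \<chi> (c * s))"

definition perfect_pairing ::
    "('a, 'm) monoid_scheme \<Rightarrow> ('b, 'n) monoid_scheme \<Rightarrow> ('c, 'k) monoid_scheme \<Rightarrow>
     ('a \<Rightarrow> 'b \<Rightarrow> 'c) \<Rightarrow> bool" where
  "perfect_pairing A B C e \<longleftrightarrow>
     (\<forall>a\<in>carrier A. e a \<in> hom B C) \<and>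
     (\<forall>b\<in>carrier B. (\<lambda>a. e a b) \<in> hom A C) \<and>
     (\<forall>\<psi>\<in>hom B C. \<exists>!a. a \<in> carrier A \<and> (\<forall>b\<in>carrier B. \<psi> b = e a b)) \<and>
     (\<forall>\<psi>\<in>hom A C. \<exists>!b. b \<in> carrier B \<and> (\<forall>a\<in>carrier A. \<psi> a = e a b))"

text \<open>
  The action of a coset \<open>K\<close> of the window on pairs of residual classes, through conjugation
  \<open>X(c, s) \<mapsto> m X(c, s) m\<inverse> = X(c', s')\<close> on the parameters, for \<open>m\<close> in \<open>K\<close>.
\<close>

definition resid_act ::
    "nat \<Rightarrow> nat \<Rightarrow> nat \<Rightarrow> (int \<Rightarrow> complex) \<Rightarrow> nat \<Rightarrow> nat \<Rightarrow>
     (complex mat \<times> complex mat) set set \<Rightarrow> int set \<times> int set \<Rightarrow> int set \<times> int set" where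
  "resid_act p r q \<chi> \<alpha> \<beta> K =
     (\<lambda>(C, S) \<in> carrier (resid p r q \<alpha>) \<times> carrier (resid p r q \<beta>).
        THE D. D \<in> carrier (resid p r q \<alpha>) \<times> carrier (resid p r q \<beta>) \<and>
          (\<forall>m\<in>K. \<forall>c\<in>C. \<forall>s\<in>S. \<exists>c'\<in>fst D. \<exists>s'\<in>snd D.
             m \<otimes>\<^bsub>proj_aut p r q \<chi>\<^esub> X_elt p r q \<chi> c s
               \<otimes>\<^bsub>proj_aut p r q \<chi>\<^esub> inv\<^bsub>proj_aut p r q \<chi>\<^esub> m = X_elt p r q \<chi> c' s'))"

end

theory Submission
  imports Defs
begin

text \<open>
  A monomial automorphism of \<open>H\<close> is a pair of permutations with phases.  Evaluating the intertwining
  relation on the row and column of \<open>0\<close> determines the phases up to a common scalar, and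
  faithfulness of \<open>\<chi>\<close> turns what remains into congruences that force both permutations to be
  fractional linear.  So the projective group consists of the elements \<open>M(v, u, l)\<close>, which multiply
  like matrices up to unit scalars.

  Conjugating \<open>X(c, s)\<close> by \<open>M(v, u, l)\<close> gives an element with diagonal parameter
  \<open>(\<Delta> + A) / (\<Delta> - A)\<close>.  Since \<open>p\<close> is odd, this is \<open>1\<close> only if \<open>A = p^r (u c - l v s)\<close> vanishes
  modulo \<open>p^q\<close>.  Testing the generators \<open>(p^\<alpha>, 0)\<close> and \<open>(0, p^\<beta>)\<close> of the window yields
  \<open>p^\<beta> dvd u\<close> and \<open>p^\<alpha> dvd v\<close>: any element that conjugates a window into the set of all \<open>X(c, s)\<close>
  already normalizes it.  This gives both the normalizer and the nonconjugacy.
\<close>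

section \<open>Matrices\<close>

text \<open>Elements of R_q are integers throughout, so one group element has many triples;
  \<open>M_eq_iff\<close> says when two triples agree. Division is avoided: permutations and the
  group law are recorded as congruences multiplied by the unit denominators 1 + p^r(...), and each
  algebraic step becomes a polynomial identity with explicit multipliers. The phases are these
  denominators seen through \<chi>. Denominators of composed fractional linear maps multiply up to
  one constant, which is why rows and columns of a product pick up the same scalar. Two moduli have
  to be kept apart: the lower left entry of a matrix is known modulo p^(q + r), the other entries
  modulo p^q. The condition \<alpha> + \<beta> = q - r enters as p^\<alpha> p^\<beta> p^r = p^q. It
  makes all correction terms p^r v u vanish on the normalizer, which thereby becomes a semidirect
  product of the window with the units \<lambda>. It also makes c s a multiple of p^(q-r) on the
  window, where the multiplicative character turns additive; perfectness of the residual pairing is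
  then a count of roots of unity.\<close>

definition row_mat :: "nat \<Rightarrow> (nat \<Rightarrow> 'a::zero) \<Rightarrow> (nat \<Rightarrow> nat) \<Rightarrow> 'a mat" where
  "row_mat n f \<sigma> = mat n n (\<lambda>(a, a'). if a' = \<sigma> a then f a else 0)"

definition col_mat :: "nat \<Rightarrow> (nat \<Rightarrow> 'a::zero) \<Rightarrow> (nat \<Rightarrow> nat) \<Rightarrow> 'a mat" where
  "col_mat n g \<tau> = mat n n (\<lambda>(b', b). if b' = \<tau> b then g b else 0)"

lemma row_mat_carrier [simp]: "row_mat n f \<sigma> \<in> carrier_mat n n"
  by (simp add: row_mat_def)

lemma col_mat_carrier [simp]: "col_mat n g \<tau> \<in> carrier_mat n n"
  by (simp add: col_mat_def)

lemma dim_row_mat [simp]: "dim_row (row_mat n f \<sigma>) = n" "dim_col (row_mat n f \<sigma>) = n"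
  by (simp_all add: row_mat_def)

lemma dim_col_mat [simp]: "dim_row (col_mat n g \<tau>) = n" "dim_col (col_mat n g \<tau>) = n"
  by (simp_all add: col_mat_def)

lemma row_mat_index [simp]:
  "a < n \<Longrightarrow> a' < n \<Longrightarrow> row_mat n f \<sigma> $$ (a, a') = (if a' = \<sigma> a then f a else 0)"
  by (simp add: row_mat_def)

lemma col_mat_index [simp]:
  "b' < n \<Longrightarrow> b < n \<Longrightarrow> col_mat n g \<tau> $$ (b', b) = (if b' = \<tau> b then g b else 0)"
  by (simp add: col_mat_def)

lemma index_row_mat_mult:
  fixes f :: "nat \<Rightarrow> 'a::semiring_0"
  assumes "A \<in> carrier_mat n k" "a < n" "b < k" "\<sigma> a < n"
  shows "(row_mat n f \<sigma> * A) $$ (a, b) = f a * A $$ (\<sigma> a, b)"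
proof -
  have "(row_mat n f \<sigma> * A) $$ (a, b)
      = (\<Sum>i\<in>{0..<n}. row_mat n f \<sigma> $$ (a, i) * A $$ (i, b))"
    using assms by (auto simp add: scalar_prod_def intro!: sum.cong)
  also have "\<dots> = (\<Sum>i\<in>{0..<n}. if i = \<sigma> a then f a * A $$ (\<sigma> a, b) else 0)"
    using assms by (intro sum.cong) auto
  finally show ?thesis
    using assms by simp
qed

lemma index_mult_col_mat:
  fixes g :: "nat \<Rightarrow> 'a::semiring_0"
  assumes "A \<in> carrier_mat k n" "a < k" "b < n" "\<tau> b < n"
  shows "(A * col_mat n g \<tau>) $$ (a, b) = A $$ (a, \<tau> b) * g b"
proof -
  have "(A * col_mat n g \<tau>) $$ (a, b)
      = (\<Sum>i\<in>{0..<n}. A $$ (a, i) * col_mat n g \<tau> $$ (i, b))"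
    using assms by (auto simp add: scalar_prod_def intro!: sum.cong)
  also have "\<dots> = (\<Sum>i\<in>{0..<n}. if i = \<tau> b then A $$ (a, \<tau> b) * g b else 0)"
    using assms by (intro sum.cong) auto
  finally show ?thesis
    using assms by simp
qed

lemma col_mat_mult:
  fixes g g' :: "nat \<Rightarrow> 'a::semiring_0"
  assumes "\<And>b. b < n \<Longrightarrow> \<tau>' b < n"
  shows "col_mat n g \<tau> * col_mat n g' \<tau>' = col_mat n (\<lambda>b. g (\<tau>' b) * g' b) (\<lambda>b. \<tau> (\<tau>' b))"
proof (rule eq_matI)
  fix i j assume "i < dim_row (col_mat n (\<lambda>b. g (\<tau>' b) * g' b) (\<lambda>b. \<tau> (\<tau>' b)))"
    "j < dim_col (col_mat n (\<lambda>b. g (\<tau>' b) * g' b) (\<lambda>b. \<tau> (\<tau>' b)))"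
  then have "i < n" "j < n" by (simp_all add: col_mat_def)
  then show "(col_mat n g \<tau> * col_mat n g' \<tau>') $$ (i, j)
      = col_mat n (\<lambda>b. g (\<tau>' b) * g' b) (\<lambda>b. \<tau> (\<tau>' b)) $$ (i, j)"
    using index_mult_col_mat[OF col_mat_carrier[of n g \<tau>], of i j \<tau>' g'] assms[of j] by simp
qed (simp_all add: col_mat_def)

text \<open>Only one of the two shapes has to be studied in each argument; transposition carries the
  result over to the other.\<close>

lemma transpose_row_mat: "transpose_mat (row_mat n f \<sigma>) = col_mat n f \<sigma>"
  by (rule eq_matI) (auto simp: row_mat_def col_mat_def)

lemma monomial_mat_transpose:
  assumes "monomial_mat n P"
  shows "monomial_mat n (transpose_mat P)"
proof -
  have P: "P \<in> carrier_mat n n"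
    and row: "\<And>i. i < n \<Longrightarrow> \<exists>!j. j < n \<and> P $$ (i, j) \<noteq> 0"
    and col: "\<And>j. j < n \<Longrightarrow> \<exists>!i. i < n \<and> P $$ (i, j) \<noteq> 0"
    using assms by (auto simp: monomial_mat_def)
  have "(\<lambda>j. j < n \<and> transpose_mat P $$ (i, j) \<noteq> 0) = (\<lambda>j. j < n \<and> P $$ (j, i) \<noteq> 0)"
    "(\<lambda>j. j < n \<and> transpose_mat P $$ (j, i) \<noteq> 0) = (\<lambda>j. j < n \<and> P $$ (i, j) \<noteq> 0)"
    if "i < n" for i
    using that P by auto
  then show ?thesis
    using P row col by (simp add: monomial_mat_def)
qed

text \<open>Uniqueness of the nonzero entry in each row defines \<open>\<sigma>\<close>; uniqueness
  in each column makes it injective.\<close>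

lemma monomial_mat_row_mat:
  assumes "monomial_mat n P"
  obtains f \<sigma> where "P = row_mat n f \<sigma>" "\<And>a. a < n \<Longrightarrow> \<sigma> a < n" "\<And>a. a < n \<Longrightarrow> f a \<noteq> 0"
    "inj_on \<sigma> {..<n}"
proof -
  have P: "P \<in> carrier_mat n n"
    and row: "\<And>i. i < n \<Longrightarrow> \<exists>!j. j < n \<and> P $$ (i, j) \<noteq> 0"
    and col: "\<And>j. j < n \<Longrightarrow> \<exists>!i. i < n \<and> P $$ (i, j) \<noteq> 0"
    using assms by (auto simp: monomial_mat_def)
  define \<sigma> where "\<sigma> i = (THE j. j < n \<and> P $$ (i, j) \<noteq> 0)" for i
  have \<sigma>: "\<sigma> i < n \<and> P $$ (i, \<sigma> i) \<noteq> 0" if "i < n" for i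
    unfolding \<sigma>_def by (rule theI') (rule row[OF that])
  have \<sigma>_eq: "j = \<sigma> i" if "i < n" "j < n" "P $$ (i, j) \<noteq> 0" for i j
    using row[OF that(1)] that \<sigma>[OF that(1)] by blast
  have "P = row_mat n (\<lambda>i. P $$ (i, \<sigma> i)) \<sigma>"
    using P \<sigma>_eq by (intro eq_matI) auto
  moreover have "inj_on \<sigma> {..<n}"
    using \<sigma> col by (intro inj_onI) (metis lessThan_iff)
  ultimately show thesis
    using that \<sigma> by blast
qed

lemma monomial_mat_col_mat:
  assumes "monomial_mat n Q"
  obtains g \<tau> where "Q = col_mat n g \<tau>" "\<And>a. a < n \<Longrightarrow> \<tau> a < n" "\<And>a. a < n \<Longrightarrow> g a \<noteq> 0"
    "inj_on \<tau> {..<n}"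
  using monomial_mat_row_mat[OF monomial_mat_transpose[OF assms]]
  by (metis transpose_row_mat transpose_transpose)

lemma monomial_mat_row_matI:
  assumes "\<And>a. a < n \<Longrightarrow> \<sigma> a < n" "\<And>a. a < n \<Longrightarrow> f a \<noteq> 0" "inj_on \<sigma> {..<n}"
  shows "monomial_mat n (row_mat n f \<sigma>)"
proof -
  \<comment> \<open>A nonzero entry in every column requires surjectivity, which follows from
    injectivity on a finite set.\<close>
  have "\<sigma> ` {..<n} = {..<n}"
    using assms by (intro endo_inj_surj) auto
  then have "\<exists>!i. i < n \<and> row_mat n f \<sigma> $$ (i, j) \<noteq> 0" if "j < n" for j
  proof -
    from that \<open>\<sigma> ` {..<n} = {..<n}\<close> obtain i where "i < n" "\<sigma> i = j"
      by (metis imageE lessThan_iff)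
    show ?thesis
    proof (rule ex1I)
      show "i < n \<and> row_mat n f \<sigma> $$ (i, j) \<noteq> 0"
        using \<open>i < n\<close> \<open>\<sigma> i = j\<close> \<open>j < n\<close> assms(2) by simp
      show "i' = i" if "i' < n \<and> row_mat n f \<sigma> $$ (i', j) \<noteq> 0" for i'
        using that \<open>i < n\<close> \<open>\<sigma> i = j\<close> \<open>j < n\<close> assms(3)
        by (metis inj_onD lessThan_iff row_mat_index)
    qed
  qed
  moreover have "\<exists>!j. j < n \<and> row_mat n f \<sigma> $$ (i, j) \<noteq> 0" if "i < n" for i
    using that assms by (intro ex1I[of _ "\<sigma> i"]) (auto split: if_splits)
  ultimately show ?thesis
    by (auto simp: monomial_mat_def)
qed

lemma monomial_mat_col_matI:
  assumes "\<And>a. a < n \<Longrightarrow> \<tau> a < n" "\<And>a. a < n \<Longrightarrow> g a \<noteq> 0" "inj_on \<tau> {..<n}"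
  shows "monomial_mat n (col_mat n g \<tau>)"
  using monomial_mat_transpose[OF monomial_mat_row_matI[OF assms]] by (simp add: transpose_row_mat)

lemma mat2_index [simp]:
  "mat2 a b c d $$ (0, 0) = a" "mat2 a b c d $$ (0, 1) = b" "mat2 a b c d $$ (0, Suc 0) = b"
  "mat2 a b c d $$ (1, 0) = c" "mat2 a b c d $$ (Suc 0, 0) = c"
  "mat2 a b c d $$ (1, 1) = d" "mat2 a b c d $$ (Suc 0, Suc 0) = d"
  by (simp_all add: mat2_def mat_of_rows_list_def)

lemma mat2_carrier [simp]: "mat2 a b c d \<in> carrier_mat 2 2"
  by (simp add: mat2_def mat_of_rows_list_def numeral_2_eq_2)

lemma dim_mat2 [simp]: "dim_row (mat2 a b c d) = 2" "dim_col (mat2 a b c d) = 2"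
  by (rule carrier_matD[OF mat2_carrier])+

lemma index_mult_mat_2:
  fixes A B :: "int mat"
  assumes "A \<in> carrier_mat 2 2" "B \<in> carrier_mat 2 2" "i < 2" "j < 2"
  shows "(A * B) $$ (i, j) = A $$ (i, 0) * B $$ (0, j) + A $$ (i, 1) * B $$ (1, j)"
  using assms by (simp add: scalar_prod_def numeral_2_eq_2)

section \<open>Congruences\<close>

text \<open>Certificate form of modular reasoning: the caller supplies multipliers that write the
  difference as a combination of known differences, and what remains is a polynomial identity over
  the integers.\<close>

lemma cong_combination1:
  fixes x y a b c :: int
  assumes "[a = b] (mod m)" "x - y = c * (a - b)"
  shows "[x = y] (mod m)"
  using assms by (auto simp: cong_iff_dvd_diff)

lemma cong_combination2:
  fixes x y a b c a' b' c' :: int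
  assumes "[a = b] (mod m)" "[a' = b'] (mod m)" "x - y = c * (a - b) + c' * (a' - b')"
  shows "[x = y] (mod m)"
  using assms by (auto simp: cong_iff_dvd_diff)

lemma cong_combination3:
  fixes x y a b c a' b' c' a'' b'' c'' :: int
  assumes "[a = b] (mod m)" "[a' = b'] (mod m)" "[a'' = b''] (mod m)"
    "x - y = c * (a - b) + c' * (a' - b') + c'' * (a'' - b'')"
  shows "[x = y] (mod m)"
  using assms by (auto simp: cong_iff_dvd_diff)

text \<open>Calls with fewer than five relations repeat one of them with multiplier 0.\<close>

lemma cong_combination5:
  fixes x y :: int
  assumes "[a1 = b1] (mod m)" "[a2 = b2] (mod m)" "[a3 = b3] (mod m)" "[a4 = b4] (mod m)"
    "[a5 = b5] (mod m)"
    "x - y = c1 * (a1 - b1) + c2 * (a2 - b2) + c3 * (a3 - b3) + c4 * (a4 - b4) + c5 * (a5 - b5)"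
  shows "[x = y] (mod m)"
proof -
  have "m dvd c1 * (a1 - b1) + c2 * (a2 - b2) + c3 * (a3 - b3) + c4 * (a4 - b4) + c5 * (a5 - b5)"
    using assms(1-5) by (intro dvd_add dvd_mult) (simp_all add: cong_iff_dvd_diff)
  then show ?thesis
    using assms(6) by (simp add: cong_iff_dvd_diff)
qed

text \<open>The exponents \<alpha> and \<beta> are fixed only later, so that facts about windows
  proved here apply to two different pairs at once.\<close>

locale polarized =
  fixes p r q :: nat and \<chi> :: "int \<Rightarrow> complex"
  assumes prime_p: "prime p" and odd_p: "odd p" and r_pos: "1 \<le> r" and r_less_q: "r < q"
    and faithful: "faithful_character p r q \<chi>"
begin

abbreviation m :: int where "m \<equiv> int p ^ q"
abbreviation pr :: int where "pr \<equiv> int p ^ r"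
abbreviation n :: nat where "n \<equiv> p ^ q"
abbreviation unit :: "int \<Rightarrow> bool" where "unit x \<equiv> coprime x (int p)"
abbreviation chi :: "int \<Rightarrow> complex" where "chi \<equiv> chi1 p r q \<chi>"
abbreviation inv_m :: "int \<Rightarrow> int" where "inv_m \<equiv> modular_inverse m"

lemma p_gt_1: "1 < p" using prime_p by (rule prime_gt_1_nat)
lemma p_pos [simp]: "0 < p" using p_gt_1 by simp
lemma p_nonzero [simp]: "p \<noteq> 0"
  using p_pos by blast
lemma m_gt_1: "1 < m" using p_gt_1 r_less_q by (intro one_less_power) auto
lemma n_gt_1: "1 < n" using p_gt_1 r_less_q by (intro one_less_power) auto
lemma int_less_m_iff: "int b < m \<longleftrightarrow> b < n"
  by (metis of_nat_less_iff of_nat_power)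
lemma pr_gt_1: "1 < pr" using p_gt_1 r_pos by (intro one_less_power) auto
lemma m_pos [simp]: "0 < m" using m_gt_1 by linarith
lemma p_dvd_pr: "int p dvd pr" using r_pos by (simp add: dvd_power)
lemma pr_dvd_m: "pr dvd m" using r_less_q by (simp add: le_imp_power_dvd)
lemma p_dvd_m: "int p dvd m" using r_less_q by (simp add: dvd_power)

lemma unit_iff: "unit x \<longleftrightarrow> \<not> int p dvd x"
proof -
  have "prime (int p)" using prime_p by simp
  then show ?thesis
    by (metis coprime_commute prime_imp_coprime coprime_absorb_left not_prime_unit)
qed

lemma coprime_m_iff: "coprime x m \<longleftrightarrow> unit x"
  using r_less_q by simp

lemma unit_cong: "[x = y] (mod int p) \<Longrightarrow> unit x \<longleftrightarrow> unit y"
  by (simp add: unit_iff cong_dvd_iff)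

lemma cong_m_imp_p: "[x = y] (mod m) \<Longrightarrow> [x = y] (mod int p)"
  using p_dvd_m cong_dvd_modulus by blast

text \<open>As r is positive, p divides p^r. Hence all denominators 1 + p^r(...) are invertible, and
  so are all determinants and diagonal entries l + p^r(...) with l a unit.\<close>

lemma unit_add_pr: "unit (x + pr * y) \<longleftrightarrow> unit x"
proof -
  have "[x + pr * y = x] (mod int p)"
    using p_dvd_pr by (simp add: cong_iff_dvd_diff)
  then show ?thesis by (rule unit_cong)
qed

lemma unit_1_pr: "unit (1 + pr * y)"
  using unit_add_pr[of 1] by simp

lemma unit_inv_m: "unit x \<Longrightarrow> unit (inv_m x)"
  using coprime_modular_inverse[of x m] coprime_m_iff by blast

lemma inv_m_right: "unit x \<Longrightarrow> [x * inv_m x = 1] (mod m)"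
  by (rule cong_modular_inverse1) (simp add: coprime_m_iff)

lemma cancel_unit: "unit w \<Longrightarrow> [w * x = w * y] (mod m) \<Longrightarrow> [x = y] (mod m)"
  using cong_mult_lcancel[of w m x y] by (simp add: coprime_m_iff)

lemma cong_inv_m_iff:
  assumes "unit w"
  shows "[x = y * inv_m w] (mod m) \<longleftrightarrow> [w * x = y] (mod m)"
proof
  assume "[x = y * inv_m w] (mod m)"
  from this inv_m_right[OF assms] show "[w * x = y] (mod m)"
    by (rule cong_combination2[where c = w and c' = y]) (simp add: algebra_simps)
next
  assume "[w * x = y] (mod m)"
  from this inv_m_right[OF assms] show "[x = y * inv_m w] (mod m)"
    by (rule cong_combination2[where c = "inv_m w" and c' = "-x"]) (simp add: algebra_simps)
qed

section \<open>The character\<close>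

lemma residues_qr: "residues (int p ^ (q + r))"
  using p_gt_1 r_less_q by unfold_locales (intro one_less_power, auto)

lemma residues_q: "residues m"
  using m_gt_1 by unfold_locales

lemma principal_unit: "(1 + pr * t) mod int p ^ (q + r) \<in> carrier (principal_units p r q)"
proof -
  interpret qr: residues "int p ^ (q + r)" "Rq p (q + r)"
    by (rule residues_qr) simp
  have "coprime (1 + pr * t) (int p ^ (q + r))"
    using unit_1_pr by simp
  then have "(1 + pr * t) mod int p ^ (q + r) \<in> Units (Rq p (q + r))"
    using qr.m_gt_one by simp
  moreover have "[(1 + pr * t) mod int p ^ (q + r) = 1] (mod pr)"
    by (simp add: cong_def mod_mod_cancel le_imp_power_dvd)
  ultimately show ?thesis
    by (simp add: principal_units_def)
qed

lemma chi_hom: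
  assumes "x \<in> carrier (principal_units p r q)" "y \<in> carrier (principal_units p r q)"
  shows "\<chi> ((x * y) mod int p ^ (q + r)) = \<chi> x * \<chi> y" "\<chi> x \<noteq> 0"
proof -
  have hom: "\<chi> \<in> hom (principal_units p r q) (complex_mult_on (- {0}))"
    using faithful by (simp add: faithful_character_def)
  show "\<chi> x \<noteq> 0"
    using hom_in_carrier[OF hom assms(1)] by (simp add: complex_mult_on_def)
  show "\<chi> ((x * y) mod int p ^ (q + r)) = \<chi> x * \<chi> y"
    using hom_mult[OF hom assms]
    by (simp add: complex_mult_on_def principal_units_def units_of_def residue_ring_def)
qed

lemma chi_nonzero [simp]: "chi t \<noteq> 0"
  unfolding chi1_def using chi_hom(2) principal_unit by blast

text \<open>Passage between the two moduli. It serves both the argument 1 + p^r t of the character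
  and the lower left entry of a matrix.\<close>

lemma cong_scale_pr: "[x = y] (mod m) \<longleftrightarrow> [pr * x = pr * y] (mod int p ^ (q + r))"
proof -
  have "int p ^ (q + r) dvd pr * (x - y) \<longleftrightarrow> m dvd (x - y)"
    using p_gt_1 by (simp add: power_add mult.commute[of _ pr])
  then show ?thesis
    by (simp add: cong_iff_dvd_diff right_diff_distrib)
qed

lemma chi_eq_iff: "chi s = chi t \<longleftrightarrow> [s = t] (mod m)"
proof -
  have "inj_on \<chi> (carrier (principal_units p r q))"
    using faithful by (simp add: faithful_character_def)
  then have "chi s = chi t \<longleftrightarrow> [1 + pr * s = 1 + pr * t] (mod int p ^ (q + r))"
    unfolding chi1_def using principal_unit by (simp add: inj_on_eq_iff cong_def)
  then show ?thesis
    by (simp add: cong_scale_pr cong_add_lcancel)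
qed

text \<open>The product (1 + p^r s)(1 + p^r t) written again in the form 1 + p^r(...).\<close>

lemma chi_mult: "chi s * chi t = chi (s + t + pr * s * t)"
proof -
  have "chi s * chi t = \<chi> ((((1 + pr * s) mod int p ^ (q + r)) *
      ((1 + pr * t) mod int p ^ (q + r))) mod int p ^ (q + r))"
    unfolding chi1_def by (rule chi_hom(1)[symmetric]; rule principal_unit)
  also have "\<dots> = \<chi> ((1 + pr * (s + t + pr * s * t)) mod int p ^ (q + r))"
    by (simp add: mod_mult_eq algebra_simps)
  finally show ?thesis by (simp add: chi1_def)
qed

lemma chi_0 [simp]: "chi 0 = 1"
  using chi_mult[of 0 0] by simp

text \<open>Faithfulness of the character turns identities between phases into congruences.\<close>

lemma chi_mult_eq_iff:
  "chi s * chi t = chi s' * chi t' \<longleftrightarrow> [s + t + pr * s * t = s' + t' + pr * s' * t'] (mod m)"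
  by (simp add: chi_mult chi_eq_iff)

section \<open>The normal form of monomial automorphisms\<close>

abbreviation cperm :: "int \<Rightarrow> int \<Rightarrow> int \<Rightarrow> nat \<Rightarrow> nat" where "cperm \<equiv> col_perm p r q"
abbreviation rperm :: "int \<Rightarrow> int \<Rightarrow> int \<Rightarrow> nat \<Rightarrow> nat" where "rperm \<equiv> row_perm p r q"

text \<open>Exchanging v with u exchanges rows with columns, so column permutations are all that
  needs study.\<close>

lemma rperm_eq_cperm: "rperm v u l = cperm u v l"
  by (simp add: row_perm_def col_perm_def fun_eq_iff)

lemma cperm_less: "cperm v u l b < n"
  unfolding col_perm_def by (simp add: nat_less_iff)

lemma cperm_eq_iff:
  assumes "x < n"
  shows "x = cperm v u l b \<longleftrightarrow> [(1 + pr * v * int b) * int x = u + l * int b] (mod m)"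
proof -
  have w: "unit (1 + pr * v * int b)"
    using unit_1_pr[of "v * int b"] by (simp add: mult.assoc)
  have "x = cperm v u l b \<longleftrightarrow> int x = ((u + l * int b) * inv_m (1 + pr * v * int b)) mod m"
    unfolding col_perm_def using pos_mod_sign[OF m_pos] by (auto simp: mult.assoc)
  also have "\<dots> \<longleftrightarrow> [int x = (u + l * int b) * inv_m (1 + pr * v * int b)] (mod m)"
    using assms int_less_m_iff[of x] by (simp add: cong_def)
  finally show ?thesis
    using w by (simp add: cong_inv_m_iff)
qed

lemma cperm_cong: "[(1 + pr * v * int b) * int (cperm v u l b) = u + l * int b] (mod m)"
  using cperm_eq_iff[OF cperm_less] by blast

lemma cperm_inj:
  assumes "unit l"
  shows "inj_on (cperm v u l) {..<n}"
proof (rule inj_onI)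
  fix b b' assume b: "b \<in> {..<n}" "b' \<in> {..<n}" and eq: "cperm v u l b = cperm v u l b'"
  let ?x = "int (cperm v u l b)"
  have "unit (l - pr * u * v)"
    using assms unit_add_pr[of l "- (u * v)"] by (simp add: mult.assoc)
  \<comment> \<open>Eliminating the common image from the two defining congruences leaves the
    determinant of (l, u; p^r v, 1) as the factor of b - b'.\<close>
  moreover have "[(l - pr * u * v) * int b = (l - pr * u * v) * int b'] (mod m)"
    using cperm_cong[of v b u l] cperm_cong[of v b' u l] unfolding eq[symmetric]
    by (rule cong_combination2[where c = "- (1 + pr * v * int b')" and c' = "1 + pr * v * int b"])
      (simp add: algebra_simps)
  ultimately have "[int b = int b'] (mod m)"
    by (rule cancel_unit)
  then show "b = b'"
    using b int_less_m_iff[of b] int_less_m_iff[of b'] by (simp add: cong_def)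
qed

section \<open>Explicit representatives: products and the intertwining relation\<close>

abbreviation H :: "complex mat" where "H \<equiv> H_mat p r q \<chi>"
abbreviation K :: "(complex mat \<times> complex mat) monoid" where "K \<equiv> monomial_aut n H"

text \<open>A representative of the coset \<open>M v u l\<close>. Its phases at row 0 and column 0
  are 1, which pins down the scalar when two representatives are compared.\<close>

definition rep :: "int \<Rightarrow> int \<Rightarrow> int \<Rightarrow> complex mat \<times> complex mat" where
  "rep v u l = (row_mat n (\<lambda>a. chi (u * int a)) (rperm v u l),
                col_mat n (\<lambda>b. chi (v * int b)) (cperm v u l))"

definition scale_pair :: "complex \<Rightarrow> complex mat \<times> complex mat \<Rightarrow> complex mat \<times> complex mat" where
  "scale_pair z x = (z \<cdot>\<^sub>m fst x, z \<cdot>\<^sub>m snd x)"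

text \<open>The group law with the normalizing factor \<open>w = 1 + p^r v u'\<close> multiplied out.\<close>

definition prod_rel :: "int \<times> int \<times> int \<Rightarrow> int \<times> int \<times> int \<Rightarrow> int \<times> int \<times> int \<Rightarrow> bool" where
  "prod_rel = (\<lambda>(v, u, l) (v', u', l') (v'', u'', l'').
     [(1 + pr * v * u') * v'' = v * l' + v'] (mod m) \<and>
     [(1 + pr * v * u') * u'' = l * u' + u] (mod m) \<and>
     [(1 + pr * v * u') * l'' = l * l' + pr * u * v'] (mod m))"

lemma rep_carrier: "fst (rep v u l) \<in> carrier_mat n n" "snd (rep v u l) \<in> carrier_mat n n"
  by (simp_all add: rep_def)

lemma transpose_snd_rep: "transpose_mat (snd (rep v u l)) = fst (rep u v l)"
  by (simp add: rep_def rperm_eq_cperm flip: transpose_row_mat)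

lemma col_mat_eq_smult:
  fixes g g' :: "nat \<Rightarrow> complex"
  assumes "\<And>b. b < k \<Longrightarrow> g b = z * g' b" "\<And>b. b < k \<Longrightarrow> \<tau> b = \<tau>' b"
  shows "col_mat k g \<tau> = z \<cdot>\<^sub>m col_mat k g' \<tau>'"
  using assms by (intro eq_matI) auto

lemma cperm_comp:
  assumes "prod_rel (v, u, l) (v', u', l') (v'', u'', l'')"
  shows "cperm v u l (cperm v' u' l' b) = cperm v'' u'' l'' b"
proof -
  define y where "y = cperm v' u' l' b"
  define x where "x = cperm v u l y"
  define w where "w = 1 + pr * v * u'"
  have "unit w"
    using unit_1_pr[of "v * u'"] by (simp add: w_def mult.assoc)
  have E: "[w * v'' = v * l' + v'] (mod m)" "[w * u'' = l * u' + u] (mod m)"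
    "[w * l'' = l * l' + pr * u * v'] (mod m)"
    using assms by (simp_all add: prod_rel_def w_def)
  have F: "[(1 + pr * v' * int b) * int y = u' + l' * int b] (mod m)"
    unfolding y_def by (rule cperm_cong)
  have G: "[(1 + pr * v * int y) * int x = u + l * int y] (mod m)"
    unfolding x_def by (rule cperm_cong)
  \<comment> \<open>The unit w is multiplied in so that v'', u'', l'' can be replaced through
    \<open>prod_rel\<close>; the congruences for y and x then compose the two fractional linear maps
    without division.\<close>
  have "[w * ((1 + pr * v'' * int b) * int x) = w * (u'' + l'' * int b)] (mod m)"
    by (rule cong_combination5[OF E F G, where ?c1.0 = "pr * int b * int x" and ?c2.0 = "- 1"
          and ?c3.0 = "- int b" and ?c4.0 = "l - pr * v * int x" and ?c5.0 = "1 + pr * v' * int b"])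
      (simp add: w_def algebra_simps)
  then have "[(1 + pr * v'' * int b) * int x = u'' + l'' * int b] (mod m)"
    by (rule cancel_unit[OF \<open>unit w\<close>])
  then have "x = cperm v'' u'' l'' b"
    by (subst cperm_eq_iff) (simp_all add: x_def cperm_less)
  then show ?thesis
    by (simp add: x_def y_def)
qed

text \<open>With y the image of b under the second factor, the denominators satisfy (1 + p^r v y)(1
  + p^r v' b) = w (1 + p^r v'' b) modulo p^(q + r). The constant w = 1 + p^r v u' becomes the scalar
  \<open>chi (v * u')\<close>.\<close>

lemma snd_rep_mult:
  assumes "prod_rel (v, u, l) (v', u', l') (v'', u'', l'')"
  shows "snd (rep v u l) * snd (rep v' u' l') = chi (v * u') \<cdot>\<^sub>m snd (rep v'' u'' l'')"
proof -
  have "chi (v * int (cperm v' u' l' b)) * chi (v' * int b) = chi (v * u') * chi (v'' * int b)" for b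
  proof -
    have "[(1 + pr * v * u') * v'' = v * l' + v'] (mod m)"
      using assms by (simp add: prod_rel_def)
    from cperm_cong[of v' b u' l'] this show ?thesis
      unfolding chi_mult_eq_iff
      by (rule cong_combination2[where c = v and c' = "- int b"]) (simp add: algebra_simps)
  qed
  then show ?thesis
    unfolding rep_def snd_conv
    by (subst col_mat_mult) (auto intro!: col_mat_eq_smult simp: cperm_less cperm_comp[OF assms])
qed

text \<open>Transposition reverses the product and exchanges v with u. \<open>prod_rel\<close> is
  invariant under both together with the same w, so the row matrices pick up exactly the scalar of
  the column matrices, as a pair modulo scalar pairs requires.\<close>

lemma fst_rep_mult:
  assumes "prod_rel (v, u, l) (v', u', l') (v'', u'', l'')"
  shows "fst (rep v u l) * fst (rep v' u' l') = chi (v * u') \<cdot>\<^sub>m fst (rep v'' u'' l'')"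
proof -
  have "prod_rel (u', v', l') (u, v, l) (u'', v'', l'')"
    using assms by (simp add: prod_rel_def ac_simps)
  then have "snd (rep u' v' l') * snd (rep u v l) = chi (v * u') \<cdot>\<^sub>m snd (rep u'' v'' l'')"
    using snd_rep_mult by (simp add: mult.commute)
  then have "transpose_mat (snd (rep u' v' l') * snd (rep u v l))
      = transpose_mat (chi (v * u') \<cdot>\<^sub>m snd (rep u'' v'' l''))"
    by simp
  moreover have "transpose_mat (chi (v * u') \<cdot>\<^sub>m snd (rep u'' v'' l''))
      = chi (v * u') \<cdot>\<^sub>m transpose_mat (snd (rep u'' v'' l''))"
    by (rule eq_matI) auto
  ultimately show ?thesis
    by (simp add: transpose_mult[OF rep_carrier(2) rep_carrier(2)] transpose_snd_rep)
qed

lemma H_index: "a < n \<Longrightarrow> b < n \<Longrightarrow> H $$ (a, b) = chi (int a * int b)"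
  by (simp add: H_mat_def)

lemma H_carrier: "H \<in> carrier_mat n n"
  by (simp add: H_mat_def)

lemma rep_monomial:
  assumes "unit l"
  shows "monomial_mat n (fst (rep v u l))" "monomial_mat n (snd (rep v u l))"
  unfolding rep_def fst_conv snd_conv using assms
  by (auto intro!: monomial_mat_row_matI monomial_mat_col_matI
      simp: rperm_eq_cperm cperm_less cperm_inj)

text \<open>After clearing denominators both (a, b) entries are the character at 1 + p^r(u a + v b +
  l a b), an expression symmetric in the roles of rows and columns.\<close>

lemma rep_intertwines: "fst (rep v u l) * H = H * snd (rep v u l)"
proof (rule eq_matI)
  fix a b assume "a < dim_row (H * snd (rep v u l))" "b < dim_col (H * snd (rep v u l))"
  then have ab: "a < n" "b < n"
    using H_carrier rep_carrier[of v u l] by auto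
  have "chi (u * int a) * chi (int (cperm u v l a) * int b)
      = chi (int a * int (cperm v u l b)) * chi (v * int b)"
    unfolding chi_mult_eq_iff using cperm_cong[of u a v l] cperm_cong[of v b u l]
    by (rule cong_combination2[where c = "int b" and c' = "- int a"]) (simp add: algebra_simps)
  then show "(fst (rep v u l) * H) $$ (a, b) = (H * snd (rep v u l)) $$ (a, b)"
    unfolding rep_def fst_conv snd_conv rperm_eq_cperm using ab cperm_less H_carrier
    by (simp add: index_row_mat_mult index_mult_col_mat H_index del: index_mult_mat)
qed (use H_carrier rep_carrier[of v u l] in auto)

lemma monomial_mat_smult:
  fixes P :: "complex mat"
  assumes "monomial_mat k P" "z \<noteq> 0"
  shows "monomial_mat k (z \<cdot>\<^sub>m P)"
proof -
  have P: "P \<in> carrier_mat k k" using assms by (simp add: monomial_mat_def)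
  have "(\<lambda>j. j < k \<and> (z \<cdot>\<^sub>m P) $$ (i, j) \<noteq> 0) = (\<lambda>j. j < k \<and> P $$ (i, j) \<noteq> 0)"
    "(\<lambda>j. j < k \<and> (z \<cdot>\<^sub>m P) $$ (j, i) \<noteq> 0) = (\<lambda>j. j < k \<and> P $$ (j, i) \<noteq> 0)"
    if "i < k" for i
    using that P assms(2) by auto
  then show ?thesis
    using assms(1) by (simp add: monomial_mat_def)
qed

lemma scale_pair_rep_in_K:
  assumes "unit l" "z \<noteq> 0"
  shows "scale_pair z (rep v u l) \<in> carrier K"
  using assms rep_monomial[OF assms(1)] rep_intertwines[of v u l] H_carrier rep_carrier[of v u l]
  by (simp add: monomial_aut_def scale_pair_def monomial_mat_smult
      mult_smult_assoc_mat[OF rep_carrier(1) H_carrier] mult_smult_distrib[OF H_carrier rep_carrier(2)])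

lemma in_K_imp_scale_pair_rep:
  assumes "x \<in> carrier K"
  obtains z v u l where "z \<noteq> 0" "unit l" "x = scale_pair z (rep v u l)"
proof -
  obtain P Q where x: "x = (P, Q)" and "monomial_mat n P" "monomial_mat n Q" and PQ: "P * H = H * Q"
    using assms by (auto simp: monomial_aut_def)
  then obtain f \<sigma> g \<tau> where P: "P = row_mat n f \<sigma>" and Q: "Q = col_mat n g \<tau>"
    and \<sigma>: "\<And>a. a < n \<Longrightarrow> \<sigma> a < n" "inj_on \<sigma> {..<n}" and \<tau>: "\<And>b. b < n \<Longrightarrow> \<tau> b < n"
    and f: "\<And>a. a < n \<Longrightarrow> f a \<noteq> 0"
    by (metis monomial_mat_row_mat monomial_mat_col_mat)
  have entry: "f a * chi (int (\<sigma> a) * int b) = chi (int a * int (\<tau> b)) * g b"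
    if "a < n" "b < n" for a b
    using arg_cong[OF PQ, of "\<lambda>A. A $$ (a, b)"] that \<sigma>(1)[of a] \<tau>[of b] H_carrier
    unfolding P Q
    by (simp add: index_row_mat_mult index_mult_col_mat H_index del: index_mult_mat)
  have n: "0 < n" "1 < n" using n_gt_1 by auto
  \<comment> \<open>A fractional linear map sends 0 to its constant term, so u and v are the images
    of 0; z is the phase of row 0.\<close>
  define z u v where "z = f 0" and "u = int (\<tau> 0)" and "v = int (\<sigma> 0)"
  have g: "g b = z * chi (v * int b)" if "b < n" for b
    using entry[OF n(1) that] by (simp add: z_def v_def)
  have fa: "f a = z * chi (u * int a)" if "a < n" for a
    using entry[OF that n(1)] g[OF n(1)] by (simp add: u_def mult.commute)
  have "z \<noteq> 0" using f[OF n(1)] by (simp add: z_def)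
  have key: "[u * int a + (1 + pr * u * int a) * int (\<sigma> a) * int b
      = v * int b + (1 + pr * v * int b) * int (\<tau> b) * int a] (mod m)" if "a < n" "b < n" for a b
  proof -
    have "chi (u * int a) * chi (int (\<sigma> a) * int b) = chi (int a * int (\<tau> b)) * chi (v * int b)"
      using entry[OF that] \<open>z \<noteq> 0\<close> by (simp add: fa[OF that(1)] g[OF that(2)])
    then show ?thesis
      unfolding chi_mult_eq_iff by (simp add: algebra_simps)
  qed
  \<comment> \<open>The value of \<open>l\<close> is forced by \<open>(1 + p^r v b) \<tau>(b) = u + l b\<close> at \<open>b = 1\<close>.\<close>
  define l where "l = (1 + pr * v) * int (\<tau> 1) - u"
  have \<sigma>_cong: "[(1 + pr * u * int a) * int (\<sigma> a) = v + l * int a] (mod m)" if "a < n" for a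
    using key[OF that n(2)] by (rule cong_combination1[where c = 1]) (simp add: l_def algebra_simps)
  \<comment> \<open>The relation \<open>key\<close> at a = 1, with the known value of
    \<open>\<sigma>\<close> at 1 inserted: the same l serves rows and columns.\<close>
  have \<tau>_cong: "[(1 + pr * v * int b) * int (\<tau> b) = u + l * int b] (mod m)" if "b < n" for b
    using key[OF n(2) that] \<sigma>_cong[OF n(2)]
    by (rule cong_combination2[where c = "-1" and c' = "int b"]) (simp add: algebra_simps)
  have "unit l"
  proof (rule ccontr)
    assume "\<not> unit l"
    then obtain l' where l': "l = int p * l'"
      by (auto simp: unit_iff elim: dvdE)
    \<comment> \<open>If \<open>p\<close> divides \<open>l\<close>, then \<open>\<sigma>\<close> takes the same value at \<open>0\<close> and at \<open>p^(q-1)\<close>.\<close>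
    define a where "a = p ^ (q - 1)"
    have a: "a < n" "a \<noteq> 0"
      unfolding a_def using p_gt_1 r_less_q by (auto intro!: power_strict_increasing)
    have "int a * int p = m"
      using r_less_q power_minus_mult[of q "int p"] by (simp add: a_def)
    then have "l * int a = m * l'"
      by (metis l' mult.assoc mult.commute)
    then have "[l * int a = 0] (mod m)"
      by (simp add: cong_iff_dvd_diff)
    \<comment> \<open>Positivity of r makes p^r p^(q-1) vanish modulo p^q, so the denominator 1 +
      p^r u a is 1 at this a.\<close>
    moreover have "m dvd int p ^ (r + (q - 1))"
      using r_pos by (intro le_imp_power_dvd) simp
    then have "[pr * int a = 0] (mod m)"
      by (simp add: a_def cong_iff_dvd_diff power_add)
    ultimately have "[int (\<sigma> a) = int (\<sigma> 0)] (mod m)"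
      by (rule cong_combination3[OF \<sigma>_cong[OF a(1)], where c = 1 and c' = 1 and c'' = "- u * int (\<sigma> a)"])
        (simp add: v_def algebra_simps)
    then have "\<sigma> a = \<sigma> 0"
      using \<sigma>(1)[OF a(1)] \<sigma>(1)[OF n(1)] int_less_m_iff by (simp add: cong_def)
    then show False
      using inj_onD[OF \<sigma>(2)] a n by auto
  qed
  moreover have "x = scale_pair z (rep v u l)"
  proof -
    have "\<sigma> a = cperm u v l a" if "a < n" for a
      using \<sigma>_cong[OF that] \<sigma>(1)[OF that] by (simp add: cperm_eq_iff)
    moreover have "\<tau> b = cperm v u l b" if "b < n" for b
      using \<tau>_cong[OF that] \<tau>[OF that] by (simp add: cperm_eq_iff)
    moreover have "row_mat n f \<sigma> = z \<cdot>\<^sub>m row_mat n (\<lambda>a. chi (u * int a)) (cperm u v l)"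
      using calculation fa by (intro eq_matI) auto
    moreover have "col_mat n g \<tau> = z \<cdot>\<^sub>m col_mat n (\<lambda>b. chi (v * int b)) (cperm v u l)"
      using calculation g by (intro col_mat_eq_smult) auto
    ultimately show ?thesis
      by (simp add: x P Q scale_pair_def rep_def rperm_eq_cperm)
  qed
  ultimately show thesis
    using that \<open>z \<noteq> 0\<close> by blast
qed

section \<open>The group of monomial automorphisms and its scalar subgroup\<close>

lemma prod_rel_ex:
  assumes "unit l" "unit l'"
  obtains v'' u'' l'' where "unit l''" "prod_rel (v, u, l) (v', u', l') (v'', u'', l'')"
proof -
  define w where "w = 1 + pr * v * u'"
  have w: "unit w" using unit_1_pr[of "v * u'"] by (simp add: w_def mult.assoc)
  have "unit (l * l' + pr * u * v')"
    using assms unit_add_pr[of "l * l'" "u * v'"] by (simp add: mult.assoc)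
  then have "unit ((l * l' + pr * u * v') * inv_m w)"
    using unit_inv_m[OF w] by simp
  moreover have "prod_rel (v, u, l) (v', u', l')
      ((v * l' + v') * inv_m w, (l * u' + u) * inv_m w, (l * l' + pr * u * v') * inv_m w)"
    unfolding prod_rel_def using w by (simp add: w_def flip: cong_inv_m_iff)
  ultimately show thesis
    using that by blast
qed

lemma prod_rel_unit: "prod_rel (0, 0, 1) (v, u, l) (v, u, l)"
  by (simp add: prod_rel_def)

text \<open>The adjugate (1, -u; -p^r v, l) of (l, u; p^r v, 1), divided by its lower right entry l.
  The determinant is a scalar and disappears projectively.\<close>

lemma prod_rel_inv:
  assumes "unit l"
  shows "prod_rel (- v * inv_m l, - u * inv_m l, inv_m l) (v, u, l) (0, 0, 1)"
proof -
  have "[inv_m l * l = 1] (mod m)" using inv_m_right[OF assms] by (simp add: mult.commute)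
  then have "[- v * inv_m l * l + v = 0] (mod m)"
    "[1 + pr * (- v * inv_m l) * u = inv_m l * l + pr * (- u * inv_m l) * v] (mod m)"
    by (auto intro: cong_combination1[where c = "- v"] cong_combination1[where c = "- 1"] simp: algebra_simps)
  then show ?thesis
    by (simp add: prod_rel_def cong_sym_eq mult.commute)
qed

lemma smult_smult: "z \<cdot>\<^sub>m (z' \<cdot>\<^sub>m A) = (z * z') \<cdot>\<^sub>m (A :: complex mat)"
  by (rule eq_matI) auto

lemma scale_pair_scale_pair [simp]: "scale_pair z (scale_pair z' x) = scale_pair (z * z') x"
  by (simp add: scale_pair_def smult_smult)

lemma scale_pair_1 [simp]: "scale_pair 1 x = x"
  by (cases x) (auto simp: scale_pair_def intro!: eq_matI)

lemma mult_K: "x \<otimes>\<^bsub>K\<^esub> y = (fst x * fst y, snd x * snd y)"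
  by (cases x; cases y) (simp add: monomial_aut_def)

lemma one_K: "\<one>\<^bsub>K\<^esub> = rep 0 0 1"
proof -
  have "cperm 0 0 1 b = b" if "b < n" for b
    using cperm_eq_iff[OF that, of 0 0 1 b] by simp
  then have "row_mat n (\<lambda>a. chi (0 * int a)) (cperm 0 0 1) = 1\<^sub>m n"
    "col_mat n (\<lambda>b. chi (0 * int b)) (cperm 0 0 1) = 1\<^sub>m n"
    by (auto intro!: eq_matI)
  then show ?thesis
    by (simp add: monomial_aut_def rep_def rperm_eq_cperm)
qed

lemma K_carrier_mat:
  assumes "x \<in> carrier K"
  shows "fst x \<in> carrier_mat n n" "snd x \<in> carrier_mat n n"
  using assms by (auto simp: monomial_aut_def monomial_mat_def)

lemma scale_pair_mult_K:
  assumes "x \<in> carrier K" "y \<in> carrier K"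
  shows "scale_pair z x \<otimes>\<^bsub>K\<^esub> scale_pair z' y = scale_pair (z * z') (x \<otimes>\<^bsub>K\<^esub> y)"
proof -
  have "(z \<cdot>\<^sub>m A) * (z' \<cdot>\<^sub>m B) = (z * z') \<cdot>\<^sub>m (A * B)"
    if "A \<in> carrier_mat n n" "B \<in> carrier_mat n n" for A B
    using that by (simp add: mult_smult_assoc_mat[of A n n _ n] mult_smult_distrib[of A n n _ n]
        smult_smult mult.commute)
  then show ?thesis
    using K_carrier_mat[OF assms(1)] K_carrier_mat[OF assms(2)] by (simp add: mult_K scale_pair_def)
qed

lemma rep_in_K: "unit l \<Longrightarrow> rep v u l \<in> carrier K"
  using scale_pair_rep_in_K[of l 1] by simp

lemma rep_mult_K:
  assumes "prod_rel (v, u, l) (v', u', l') (v'', u'', l'')"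
  shows "rep v u l \<otimes>\<^bsub>K\<^esub> rep v' u' l' = scale_pair (chi (v * u')) (rep v'' u'' l'')"
  using fst_rep_mult[OF assms] snd_rep_mult[OF assms] by (simp add: mult_K scale_pair_def)

text \<open>Closure and inverses are read off from the normal form, so arbitrary monomial matrices
  need not be multiplied or inverted; associativity is that of matrices.\<close>

lemma group_K: "group K"
proof (rule groupI)
  fix x y assume xy: "x \<in> carrier K" "y \<in> carrier K"
  obtain z v u l where x: "z \<noteq> 0" "unit l" "x = scale_pair z (rep v u l)"
    using in_K_imp_scale_pair_rep[OF xy(1)] .
  obtain z' v' u' l' where y: "z' \<noteq> 0" "unit l'" "y = scale_pair z' (rep v' u' l')"
    using in_K_imp_scale_pair_rep[OF xy(2)] .
  obtain v'' u'' l'' where c: "unit l''" "prod_rel (v, u, l) (v', u', l') (v'', u'', l'')"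
    using prod_rel_ex[OF x(2) y(2)] .
  show "x \<otimes>\<^bsub>K\<^esub> y \<in> carrier K"
    using x y c by (simp add: scale_pair_mult_K rep_in_K rep_mult_K scale_pair_rep_in_K)
next
  show "\<one>\<^bsub>K\<^esub> \<in> carrier K"
    by (simp add: one_K rep_in_K)
next
  fix x y w assume "x \<in> carrier K" "y \<in> carrier K" "w \<in> carrier K"
  then show "x \<otimes>\<^bsub>K\<^esub> y \<otimes>\<^bsub>K\<^esub> w = x \<otimes>\<^bsub>K\<^esub> (y \<otimes>\<^bsub>K\<^esub> w)"
    using K_carrier_mat by (simp add: mult_K assoc_mult_mat[of _ n n _ n _ n])
next
  fix x assume "x \<in> carrier K"
  then show "\<one>\<^bsub>K\<^esub> \<otimes>\<^bsub>K\<^esub> x = x"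
    using K_carrier_mat[of x] by (simp add: mult_K) (simp add: monomial_aut_def)
next
  fix x assume "x \<in> carrier K"
  then obtain z v u l where x: "z \<noteq> 0" "unit l" "x = scale_pair z (rep v u l)"
    by (rule in_K_imp_scale_pair_rep)
  define y where "y = rep (- v * inv_m l) (- u * inv_m l) (inv_m l)"
  define c where "c = chi (- v * inv_m l * u)"
  \<comment> \<open>The representative y of the inverse triple times x is k times the identity, so y
    has to be divided by k.\<close>
  define k where "k = z * c"
  have y: "y \<in> carrier K"
    unfolding y_def using unit_inv_m[OF x(2)] by (rule rep_in_K)
  have "scale_pair (inverse k) y \<otimes>\<^bsub>K\<^esub> x = scale_pair (inverse k * k) (rep 0 0 1)"
  proof -
    have "y \<otimes>\<^bsub>K\<^esub> rep v u l = scale_pair c (rep 0 0 1)"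
      unfolding y_def c_def by (rule rep_mult_K[OF prod_rel_inv[OF x(2)]])
    then show ?thesis
      unfolding x(3) using y x(2) by (simp add: scale_pair_mult_K rep_in_K k_def mult.assoc)
  qed
  moreover have "k \<noteq> 0" using x(1) by (simp add: k_def c_def)
  ultimately show "\<exists>y\<in>carrier K. y \<otimes>\<^bsub>K\<^esub> x = \<one>\<^bsub>K\<^esub>"
    using scale_pair_rep_in_K[OF unit_inv_m[OF x(2)], of "inverse k" "- v * inv_m l" "- u * inv_m l"]
    by (intro bexI[of _ "scale_pair (inverse k) y"]) (simp_all add: one_K y_def)
qed

abbreviation S :: "(complex mat \<times> complex mat) set" where "S \<equiv> scalar_pairs n"

lemma S_eq: "S = {scale_pair z \<one>\<^bsub>K\<^esub> | z. z \<noteq> 0}"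
  by (simp add: scalar_pairs_def scale_pair_def monomial_aut_def)

lemma S_r_coset:
  assumes "x \<in> carrier K"
  shows "S #>\<^bsub>K\<^esub> x = {scale_pair z x | z. z \<noteq> 0}"
proof -
  interpret K: group K by (rule group_K)
  have "scale_pair z \<one>\<^bsub>K\<^esub> \<otimes>\<^bsub>K\<^esub> x = scale_pair z x" for z
    using scale_pair_mult_K[of "\<one>\<^bsub>K\<^esub>" x z 1] assms by simp
  then show ?thesis
    unfolding S_eq r_coset_def by auto
qed

lemma S_normal: "S \<lhd> K"
proof -
  interpret K: group K by (rule group_K)
  have S_mult: "scale_pair z \<one>\<^bsub>K\<^esub> \<otimes>\<^bsub>K\<^esub> scale_pair z' \<one>\<^bsub>K\<^esub> = scale_pair (z * z') \<one>\<^bsub>K\<^esub>" for z z'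
    by (simp add: scale_pair_mult_K)
  have S_in: "scale_pair z \<one>\<^bsub>K\<^esub> \<in> carrier K" if "z \<noteq> 0" for z
    using that by (simp add: one_K scale_pair_rep_in_K)
  have "subgroup S K"
  proof (rule K.subgroupI)
    show "S \<subseteq> carrier K" using S_in by (auto simp: S_eq)
    have "scale_pair 1 \<one>\<^bsub>K\<^esub> \<in> S" unfolding S_eq by (intro CollectI exI[of _ 1]) simp
    then show "S \<noteq> {}" by blast
    show "x \<otimes>\<^bsub>K\<^esub> y \<in> S" if xy: "x \<in> S" "y \<in> S" for x y
    proof -
      obtain z z' where "z \<noteq> 0" "z' \<noteq> 0" "x = scale_pair z \<one>\<^bsub>K\<^esub>" "y = scale_pair z' \<one>\<^bsub>K\<^esub>"
        using xy by (auto simp: S_eq)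
      then have "x \<otimes>\<^bsub>K\<^esub> y = scale_pair (z * z') \<one>\<^bsub>K\<^esub>" "z * z' \<noteq> 0"
        by (simp_all add: S_mult)
      then show ?thesis unfolding S_eq by blast
    qed
    show "inv\<^bsub>K\<^esub> x \<in> S" if x: "x \<in> S" for x
    proof -
      obtain z where z: "z \<noteq> 0" "x = scale_pair z \<one>\<^bsub>K\<^esub>" using x by (auto simp: S_eq)
      then have "inv\<^bsub>K\<^esub> x = scale_pair (inverse z) \<one>\<^bsub>K\<^esub>"
        by (intro K.inv_equality) (simp_all add: S_mult S_in)
      then show ?thesis unfolding S_eq using z(1) nonzero_imp_inverse_nonzero by blast
    qed
  qed
  then show ?thesis
  proof (rule K.normalI, intro ballI)
    fix x assume x: "x \<in> carrier K"
    have "x \<otimes>\<^bsub>K\<^esub> scale_pair z \<one>\<^bsub>K\<^esub> = scale_pair z x" for z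
      using scale_pair_mult_K[of x "\<one>\<^bsub>K\<^esub>" 1 z] x by simp
    moreover have "x <#\<^bsub>K\<^esub> S = {x \<otimes>\<^bsub>K\<^esub> scale_pair z \<one>\<^bsub>K\<^esub> | z. z \<noteq> 0}"
      unfolding l_coset_def S_eq by blast
    ultimately show "S #>\<^bsub>K\<^esub> x = x <#\<^bsub>K\<^esub> S"
      by (simp add: S_r_coset[OF x])
  qed
qed

section \<open>The projective group\<close>

abbreviation G where "G \<equiv> proj_aut p r q \<chi>"
abbreviation M where "M \<equiv> M_elt p r q \<chi>"
abbreviation X where "X \<equiv> X_elt p r q \<chi>"

lemma group_G: "group G"
  unfolding proj_aut_def using S_normal by (rule normal.factorgroup_is_group)

lemma M_eq_coset: "M v u l = S #>\<^bsub>K\<^esub> rep v u l"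
  by (simp add: M_elt_def rep_def row_mat_def col_mat_def)

lemma S_r_coset_scale_pair:
  assumes "x \<in> carrier K" "scale_pair z x \<in> carrier K" "z \<noteq> 0"
  shows "S #>\<^bsub>K\<^esub> scale_pair z x = S #>\<^bsub>K\<^esub> x"
proof -
  have "{scale_pair z' (scale_pair z x) | z'. z' \<noteq> 0} \<subseteq> {scale_pair z' x | z'. z' \<noteq> 0}"
    using assms(3) by auto
  moreover have "scale_pair z' x = scale_pair (z' / z) (scale_pair z x)" for z'
    using assms(3) by simp
  then have "{scale_pair z' x | z'. z' \<noteq> 0} \<subseteq> {scale_pair z' (scale_pair z x) | z'. z' \<noteq> 0}"
    using assms(3) by (smt (verit) divide_eq_0_iff mem_Collect_eq subsetI)
  ultimately show ?thesis
    using assms by (simp add: S_r_coset)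
qed

lemma carrier_G: "carrier G = {M v u l | v u l. unit l}"
proof -
  have "carrier G = {S #>\<^bsub>K\<^esub> x | x. x \<in> carrier K}"
    by (auto simp: proj_aut_def FactGroup_def RCOSETS_def)
  also have "\<dots> = {M v u l | v u l. unit l}"
  proof (intro subset_antisym subsetI)
    fix g assume "g \<in> {S #>\<^bsub>K\<^esub> x | x. x \<in> carrier K}"
    then obtain x where "x \<in> carrier K" "g = S #>\<^bsub>K\<^esub> x" by blast
    then show "g \<in> {M v u l | v u l. unit l}"
      by (metis (mono_tags, lifting) M_eq_coset S_r_coset_scale_pair in_K_imp_scale_pair_rep mem_Collect_eq rep_in_K)
  next
    fix g assume "g \<in> {M v u l | v u l. unit l}"
    then obtain v u l where "unit l" "g = M v u l" by blast
    then show "g \<in> {S #>\<^bsub>K\<^esub> x | x. x \<in> carrier K}"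
      using rep_in_K[of l v u] unfolding M_eq_coset by blast
  qed
  finally show ?thesis .
qed

lemma M_in_G: "unit l \<Longrightarrow> M v u l \<in> carrier G"
  by (auto simp: carrier_G)

lemma M_mult:
  assumes "unit l" "unit l'" "unit l''" "prod_rel (v, u, l) (v', u', l') (v'', u'', l'')"
  shows "M v u l \<otimes>\<^bsub>G\<^esub> M v' u' l' = M v'' u'' l''"
proof -
  have "M v u l \<otimes>\<^bsub>G\<^esub> M v' u' l' = S #>\<^bsub>K\<^esub> (rep v u l \<otimes>\<^bsub>K\<^esub> rep v' u' l')"
    unfolding M_eq_coset proj_aut_def mult_FactGroup
    using assms by (intro normal.rcos_sum[OF S_normal]) (simp_all add: rep_in_K)
  then show ?thesis
    using assms by (simp add: rep_mult_K M_eq_coset S_r_coset_scale_pair rep_in_K scale_pair_rep_in_K)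
qed

text \<open>In a group the only idempotent is the identity.\<close>

lemma one_G: "\<one>\<^bsub>G\<^esub> = M 0 0 1"
proof -
  interpret G: group G by (rule group_G)
  have "M 0 0 1 \<otimes>\<^bsub>G\<^esub> M 0 0 1 = M 0 0 1"
    by (rule M_mult) (simp_all add: prod_rel_unit)
  then show ?thesis using G.l_cancel_one'[of "M 0 0 1" "M 0 0 1"] M_in_G[of 1 0 0] by simp
qed

lemma rep_cong:
  assumes "[v = v'] (mod m)" "[u = u'] (mod m)" "[l = l'] (mod m)"
  shows "rep v u l = rep v' u' l'"
proof -
  have aux: "cperm v u l = cperm v' u' l'"
    if "[v = v'] (mod m)" "[u = u'] (mod m)" "[l = l'] (mod m)" for v u l v' u' l'
  proof
    fix b
    have "[(1 + pr * v' * int b) * int (cperm v u l b) = u' + l' * int b] (mod m)"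
      by (rule cong_combination5[OF cperm_cong[of v b u l] that that(3), where ?c1.0 = 1 and ?c3.0 = 1
            and ?c2.0 = "- pr * int b * int (cperm v u l b)" and ?c4.0 = "int b" and ?c5.0 = 0])
        (simp add: algebra_simps)
    then show "cperm v u l b = cperm v' u' l' b"
      by (simp add: cperm_eq_iff cperm_less)
  qed
  have "chi (u * int a) = chi (u' * int a)" "chi (v * int a) = chi (v' * int a)" for a
    using assms by (simp_all add: chi_eq_iff cong_mult)
  then show ?thesis
    using assms by (simp add: rep_def rperm_eq_cperm aux[of v v' u u' l l'] aux[of u u' v v' l l'])
qed

text \<open>Columns 0 and 1 suffice. The phase at 0 forces the scalar to be 1, the phase at 1 gives
  v by faithfulness, the image of 0 gives u, and the image of 1 then gives l.\<close>

lemma M_eq_iff: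
  assumes "unit l" "unit l'"
  shows "M v u l = M v' u' l' \<longleftrightarrow> [v = v'] (mod m) \<and> [u = u'] (mod m) \<and> [l = l'] (mod m)"
proof
  assume "M v u l = M v' u' l'"
  moreover have "rep v u l \<in> M v u l"
    unfolding M_eq_coset S_r_coset[OF rep_in_K[OF assms(1)]] by (force intro: exI[of _ 1])
  ultimately obtain z where "rep v u l = scale_pair z (rep v' u' l')" "z \<noteq> 0"
    unfolding M_eq_coset S_r_coset[OF rep_in_K[OF assms(2)]] by auto
  then have eq: "col_mat n (\<lambda>b. chi (v * int b)) (cperm v u l)
      = z \<cdot>\<^sub>m col_mat n (\<lambda>b. chi (v' * int b)) (cperm v' u' l')"
    by (simp add: rep_def scale_pair_def)
  have *: "cperm v u l b = cperm v' u' l' b \<and> chi (v * int b) = z * chi (v' * int b)"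
    if "b < n" for b
    using arg_cong[OF eq, of "\<lambda>A. A $$ (cperm v u l b, b)"] that cperm_less[of v u l b]
    by (auto split: if_splits)
  have n: "0 < n" "1 < n" using n_gt_1 by auto
  have "z = 1" using *[OF n(1)] by simp
  then have v: "[v = v'] (mod m)"
    using *[OF n(2)] by (simp add: chi_eq_iff)
  have u: "[u = u'] (mod m)"
    using cperm_cong[of v 0 u l] cperm_cong[of v' 0 u' l'] *[OF n(1)]
    by simp (metis cong_sym cong_trans)
  have "[(1 + pr * v) * int (cperm v u l 1) = u + l] (mod m)"
    "[(1 + pr * v') * int (cperm v u l 1) = u' + l'] (mod m)"
    using cperm_cong[of v 1 u l] cperm_cong[of v' 1 u' l'] *[OF n(2)] by simp_all
  from cong_combination5[OF this v u u, of l l' "-1" 1 "pr * int (cperm v u l 1)" "- 1" 0] v u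
  show "[v = v'] (mod m) \<and> [u = u'] (mod m) \<and> [l = l'] (mod m)"
    by (simp add: algebra_simps)
next
  assume "[v = v'] (mod m) \<and> [u = u'] (mod m) \<and> [l = l'] (mod m)"
  then show "M v u l = M v' u' l'"
    using rep_cong[of v v' u u' l l'] by (simp add: M_eq_coset)
qed

section \<open>Conjugation\<close>

text \<open>
  The hypotheses are the entries of \<open>I + \<Delta>\<inverse> (A, B; C, -A)\<close> after division by the lower right one.
\<close>

lemma conj_eqI:
  assumes "unit l" "unit l'"
    and "[(l - pr * u * v - pr * (u * c - l * v * s)) * v' = c - pr * v ^ 2 * s] (mod m)"
    and "[(l - pr * u * v - pr * (u * c - l * v * s)) * u' = l ^ 2 * s - pr * u ^ 2 * c] (mod m)"
    and "[(l - pr * u * v - pr * (u * c - l * v * s)) * l'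
          = l - pr * u * v + pr * (u * c - l * v * s)] (mod m)"
  shows "M v u l \<otimes>\<^bsub>G\<^esub> X c s \<otimes>\<^bsub>G\<^esub> inv\<^bsub>G\<^esub> (M v u l) = M v' u' l'"
proof -
  interpret G: group G by (rule group_G)
  define \<Delta> where "\<Delta> = l - pr * u * v"
  define A where "A = pr * (u * c - l * v * s)"
  define \<delta> where "\<delta> = \<Delta> - A"
  have D: "[\<delta> * v' = c - pr * v ^ 2 * s] (mod m)" "[\<delta> * u' = l ^ 2 * s - pr * u ^ 2 * c] (mod m)"
    "[\<delta> * l' = \<Delta> + A] (mod m)"
    using assms(3-5) by (simp_all add: \<delta>_def \<Delta>_def A_def)
  have "\<delta> = l + pr * (- u * v - (u * c - l * v * s))"
    by (simp add: \<delta>_def \<Delta>_def A_def algebra_simps)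
  then have \<delta>: "unit \<delta>" using assms(1) unit_add_pr by simp
  \<comment> \<open>Instead of multiplying by an inverse, M' M and M X are shown to have the same
    normalized triple (v1, u1, l1), M' being the claimed conjugate.\<close>
  obtain v1 u1 l1 where l1: "unit l1" and MX: "prod_rel (v, u, l) (c, s, 1) (v1, u1, l1)"
    by (rule prod_rel_ex[OF assms(1), of 1 v u c s]) simp
  have E: "[(1 + pr * v * s) * v1 = v + c] (mod m)" "[(1 + pr * v * s) * u1 = l * s + u] (mod m)"
    "[(1 + pr * v * s) * l1 = l + pr * u * c] (mod m)"
    using MX by (simp_all add: prod_rel_def)
  \<comment> \<open>Inserting \<open>D(1)\<close> gives \<delta> (1 + p^r v' u) = \<Delta> (1 + p^r
    v s) modulo p^q. This is the origin of the multiplier \<Delta> of \<open>E\<close> here and in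
    the next two steps.\<close>
  have "[\<delta> * ((1 + pr * v' * u) * v1) = \<delta> * (v' * l + v)] (mod m)"
    by (rule cong_combination2[OF D(1) E(1), where c = "pr * u * v1 - l" and c' = \<Delta>])
      (simp add: \<delta>_def \<Delta>_def A_def algebra_simps power2_eq_square)
  moreover have "[\<delta> * ((1 + pr * v' * u) * u1) = \<delta> * (l' * u + u')] (mod m)"
    by (rule cong_combination5[OF D E(2) E(2), where ?c1.0 = "pr * u * u1" and ?c2.0 = "- 1" and ?c3.0 = "- u"
          and ?c4.0 = \<Delta> and ?c5.0 = 0])
      (simp add: \<delta>_def \<Delta>_def A_def algebra_simps power2_eq_square)
  moreover have "[\<delta> * ((1 + pr * v' * u) * l1) = \<delta> * (l' * l + pr * u' * v)] (mod m)"
    by (rule cong_combination5[OF D E(3) E(3), where ?c1.0 = "pr * u * l1" and ?c2.0 = "- pr * v" and ?c3.0 = "- l"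
          and ?c4.0 = \<Delta> and ?c5.0 = 0])
      (simp add: \<delta>_def \<Delta>_def A_def algebra_simps power2_eq_square)
  ultimately have "prod_rel (v', u', l') (v, u, l) (v1, u1, l1)"
    using cancel_unit[OF \<delta>] by (simp add: prod_rel_def)
  then have "M v' u' l' \<otimes>\<^bsub>G\<^esub> M v u l = M v u l \<otimes>\<^bsub>G\<^esub> X c s"
    unfolding X_elt_def using assms l1 MX by (simp add: M_mult[of _ _ l1])
  moreover have "M v' u' l' \<in> carrier G" "M v u l \<in> carrier G" "X c s \<in> carrier G"
    using assms by (simp_all add: M_in_G X_elt_def)
  ultimately show ?thesis
    by (metis G.inv_closed G.m_assoc G.r_inv G.r_one)
qed

lemma conj_diag_unit:
  assumes "unit l" "unit \<delta>" "[\<delta> * l' = l + pr * x] (mod m)"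
  shows "unit l'"
proof -
  have "unit (\<delta> * l')"
    using unit_cong[OF cong_m_imp_p[OF assms(3)]] assms(1) unit_add_pr by simp
  then show ?thesis by simp
qed

lemma conj_is_X_imp:
  assumes "unit l" "M v u l \<otimes>\<^bsub>G\<^esub> X c s \<otimes>\<^bsub>G\<^esub> inv\<^bsub>G\<^esub> (M v u l) = X c' s'"
  shows "m dvd pr * (u * c - l * v * s)"
proof -
  define \<Delta> where "\<Delta> = l - pr * u * v"
  define A where "A = pr * (u * c - l * v * s)"
  have \<delta>_eq: "\<Delta> - A = l + pr * (- u * v - (u * c - l * v * s))"
    and \<delta>'_eq: "\<Delta> + A = l + pr * (- u * v + (u * c - l * v * s))"
    by (simp_all add: \<Delta>_def A_def algebra_simps)
  have \<delta>: "unit (\<Delta> - A)" using assms(1) unit_add_pr \<delta>_eq by simp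
  define l' where "l' = (\<Delta> + A) * inv_m (\<Delta> - A)"
  have l': "[(\<Delta> - A) * l' = \<Delta> + A] (mod m)"
    unfolding l'_def using \<delta> by (simp flip: cong_inv_m_iff)
  have "unit l'" using conj_diag_unit[OF assms(1) \<delta>] l' \<delta>'_eq by metis
  moreover have "[(\<Delta> - A) * (x * inv_m (\<Delta> - A)) = x] (mod m)" for x
    using \<delta> by (simp flip: cong_inv_m_iff)
  ultimately have "M v u l \<otimes>\<^bsub>G\<^esub> X c s \<otimes>\<^bsub>G\<^esub> inv\<^bsub>G\<^esub> (M v u l)
      = M ((c - pr * v ^ 2 * s) * inv_m (\<Delta> - A)) ((l ^ 2 * s - pr * u ^ 2 * c) * inv_m (\<Delta> - A)) l'"
    using l' assms(1) by (intro conj_eqI) (simp_all add: \<Delta>_def A_def)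
  then have "[l' = 1] (mod m)"
    using assms(2) \<open>unit l'\<close> by (simp add: X_elt_def M_eq_iff)
  from this l' have "[2 * A = 2 * 0] (mod m)"
    by (rule cong_combination2[where c = "\<Delta> - A" and c' = "- 1"]) (simp add: algebra_simps)
  moreover have "unit 2"
    using odd_p by simp
  ultimately have "[A = 0] (mod m)"
    by (metis cancel_unit)
  then show ?thesis
    by (simp add: A_def cong_0_iff)
qed

section \<open>The conjugation formula for matrices\<close>

definition conj_\<Delta> :: "int \<Rightarrow> int \<Rightarrow> int \<Rightarrow> int" where
  "conj_\<Delta> u v l = l - pr * u * v"

definition conj_A :: "int \<Rightarrow> int \<Rightarrow> int \<Rightarrow> int \<Rightarrow> int \<Rightarrow> int" where
  "conj_A u v l c s = pr * (u * c - l * v * s)"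

definition conj_B :: "int \<Rightarrow> int \<Rightarrow> int \<Rightarrow> int \<Rightarrow> int" where
  "conj_B u l c s = l ^ 2 * s - pr * u ^ 2 * c"

definition conj_C :: "int \<Rightarrow> int \<Rightarrow> int \<Rightarrow> int" where
  "conj_C v c s = pr * (c - pr * v ^ 2 * s)"

definition conj_Z :: "int \<Rightarrow> int \<Rightarrow> int \<Rightarrow> int \<Rightarrow> int \<Rightarrow> int mat" where
  "conj_Z u v l c s = 1\<^sub>m 2 + inv_m (conj_\<Delta> u v l) \<cdot>\<^sub>m
     mat2 (conj_A u v l c s) (conj_B u l c s) (conj_C v c s) (- conj_A u v l c s)"

lemmas conj_defs = conj_\<Delta>_def conj_A_def conj_B_def conj_C_def

lemma conj_Z_index:
  "conj_Z u v l c s $$ (0, 0) = 1 + inv_m (conj_\<Delta> u v l) * conj_A u v l c s"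
  "conj_Z u v l c s $$ (0, 1) = inv_m (conj_\<Delta> u v l) * conj_B u l c s"
  "conj_Z u v l c s $$ (1, 0) = inv_m (conj_\<Delta> u v l) * conj_C v c s"
  "conj_Z u v l c s $$ (1, 1) = 1 - inv_m (conj_\<Delta> u v l) * conj_A u v l c s"
  by (simp_all add: conj_Z_def)

lemma M_mat_index:
  "M_mat p r v u l $$ (0, 0) = l" "M_mat p r v u l $$ (0, 1) = u"
  "M_mat p r v u l $$ (1, 0) = pr * v" "M_mat p r v u l $$ (1, 1) = 1"
  by (simp_all add: M_mat_def)

lemma M_mat_carrier: "M_mat p r v u l \<in> carrier_mat 2 2" "X_mat p r c s \<in> carrier_mat 2 2"
  by (simp_all add: M_mat_def X_mat_def)

context
  fixes u v l c s :: int
  assumes l: "unit l"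
begin

lemma conj_\<Delta>_unit: "unit (conj_\<Delta> u v l)"
  using unit_add_pr[of l "- (u * v)"] l by (simp add: conj_\<Delta>_def mult.assoc)

lemma inverse_mat_ex:
  "\<exists>Y. Y \<in> carrier_mat 2 2 \<and> mat_cong p r q (M_mat p r v u l * Y) (1\<^sub>m 2) \<and>
     mat_cong p r q (Y * M_mat p r v u l) (1\<^sub>m 2)"
proof -
  define d where "d = inv_m (conj_\<Delta> u v l)"
  \<comment> \<open>The adjugate divided by the determinant modulo p^q. The lower left entries of
    both products with M cancel identically, so the finer modulus p^(q + r) there holds as
    well.\<close>
  define Y where "Y = mat2 d (- u * d) (- pr * v * d) (l * d)"
  have Y: "Y \<in> carrier_mat 2 2" "Y $$ (0, 0) = d" "Y $$ (0, 1) = - u * d"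
    "Y $$ (1, 0) = - pr * v * d" "Y $$ (1, 1) = l * d"
    by (simp_all add: Y_def)
  have "[conj_\<Delta> u v l * d = 1] (mod m)"
    unfolding d_def by (rule inv_m_right[OF conj_\<Delta>_unit])
  then have d: "[l * d - pr * u * v * d = 1] (mod m)"
    by (simp add: conj_\<Delta>_def algebra_simps)
  have "mat_cong p r q (M_mat p r v u l * Y) (1\<^sub>m 2)"
    unfolding mat_cong_def using d
    by (simp add: index_mult_mat_2[OF M_mat_carrier(1) Y(1)] Y(2-) M_mat_index algebra_simps
        del: One_nat_def index_mult_mat)
  moreover have "mat_cong p r q (Y * M_mat p r v u l) (1\<^sub>m 2)"
    unfolding mat_cong_def using d
    by (simp add: index_mult_mat_2[OF Y(1) M_mat_carrier(1)] Y(2-) M_mat_index algebra_simps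
        del: One_nat_def index_mult_mat)
  ultimately show ?thesis
    using Y(1) by blast
qed

text \<open>Cramer's rule determines the entries of \<open>Y\<close> modulo p^q. The delicate entry
  is the lower left one: there y10 is eliminated by an equation valid modulo p^(q + r), and y00,
  known only modulo p^q, survives only with a factor p^r.\<close>

lemma conj_mat_cong:
  assumes Y: "Y \<in> carrier_mat 2 2" and MY: "mat_cong p r q (M_mat p r v u l * Y) (1\<^sub>m 2)"
  shows "mat_cong p r q (M_mat p r v u l * X_mat p r c s * Y) (conj_Z u v l c s)"
proof -
  define d where "d = inv_m (conj_\<Delta> u v l)"
  define y00 y01 y10 y11 where "y00 = Y $$ (0, 0)" and "y01 = Y $$ (0, 1)"
    and "y10 = Y $$ (1, 0)" and "y11 = Y $$ (1, 1)"
  have d: "[conj_\<Delta> u v l * d = 1] (mod m)"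
    unfolding d_def by (rule inv_m_right[OF conj_\<Delta>_unit])
  have F: "[l * y00 + u * y10 = 1] (mod m)" "[l * y01 + u * y11 = 0] (mod m)"
    "[pr * v * y00 + y10 = 0] (mod int p ^ (q + r))" "[pr * v * y01 + y11 = 1] (mod m)"
    using MY unfolding mat_cong_def y00_def y01_def y10_def y11_def
    by (simp_all add: index_mult_mat_2[OF M_mat_carrier(1) Y] M_mat_index
        del: One_nat_def index_mult_mat)
  have F3: "[pr * v * y00 + y10 = 0] (mod m)"
    using F(3) cong_dvd_modulus le_imp_power_dvd[of q "q + r" "int p"] by simp
  have y00: "[y00 = d] (mod m)"
    by (rule cong_combination3[OF F(1) F3 d, where c = d and c' = "- u * d" and c'' = "- y00"])
      (simp add: conj_\<Delta>_def algebra_simps)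
  have y01: "[y01 = - u * d] (mod m)"
    by (rule cong_combination3[OF F(2) F(4) d, where c = d and c' = "- u * d" and c'' = "- y01"])
      (simp add: conj_\<Delta>_def algebra_simps)
  have y11: "[y11 = l * d] (mod m)"
    by (rule cong_combination3[OF F(2) F(4) d, where c = "- pr * v * d" and c' = "l * d" and c'' = "- y11"])
      (simp add: conj_\<Delta>_def algebra_simps)
  have pr_y00: "[pr * y00 = pr * d] (mod int p ^ (q + r))"
    using y00 cong_scale_pr by blast
  have "[(l + u * (pr * c)) * y00 + (l * s + u) * y10 = 1 + d * conj_A u v l c s] (mod m)"
    by (rule cong_combination3[OF F3 y00 d, where c = "l * s + u" and c'' = 1
          and c' = "l + u * (pr * c) - (l * s + u) * pr * v"])
      (simp add: conj_\<Delta>_def conj_A_def algebra_simps)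
  moreover have "[(l + u * (pr * c)) * y01 + (l * s + u) * y11 = d * conj_B u l c s] (mod m)"
    by (rule cong_combination2[OF y01 y11, where c = "l + u * (pr * c)" and c' = "l * s + u"])
      (simp add: conj_B_def algebra_simps power2_eq_square)
  moreover have "[(pr * v + pr * c) * y00 + (pr * v * s + 1) * y10 = d * conj_C v c s] (mod int p ^ (q + r))"
    by (rule cong_combination2[OF F(3) pr_y00, where c = "pr * v * s + 1"
          and c' = "v + c - (pr * v * s + 1) * v"])
      (simp add: conj_C_def algebra_simps power2_eq_square)
  moreover have "[(pr * v + pr * c) * y01 + (pr * v * s + 1) * y11 = 1 - d * conj_A u v l c s] (mod m)"
    by (rule cong_combination3[OF y01 y11 d, where c = "pr * v + pr * c" and c' = "pr * v * s + 1" and c'' = 1])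
      (simp add: conj_\<Delta>_def conj_A_def algebra_simps)
  moreover have "M_mat p r v u l * X_mat p r c s \<in> carrier_mat 2 2"
    by (rule mult_carrier_mat[OF M_mat_carrier])
  moreover have "X_mat p r c s $$ (0, 0) = 1" "X_mat p r c s $$ (0, 1) = s"
    "X_mat p r c s $$ (1, 0) = pr * c" "X_mat p r c s $$ (1, 1) = 1"
    by (simp_all add: X_mat_def)
  ultimately show ?thesis
    unfolding mat_cong_def
    by (simp add: index_mult_mat_2[OF _ Y] index_mult_mat_2[OF M_mat_carrier] M_mat_index conj_Z_index
        del: One_nat_def index_mult_mat flip: d_def y00_def y01_def y10_def y11_def)
qed

lemma conj_proj_elt:
  "M v u l \<otimes>\<^bsub>G\<^esub> X c s \<otimes>\<^bsub>G\<^esub> inv\<^bsub>G\<^esub> (M v u l) = proj_elt p r q \<chi> (conj_Z u v l c s)"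
proof -
  define d where "d = inv_m (conj_\<Delta> u v l)"
  define e where "e = inv_m (1 - d * conj_A u v l c s)"
  define \<delta> where "\<delta> = conj_\<Delta> u v l - conj_A u v l c s"
  have d: "[conj_\<Delta> u v l * d = 1] (mod m)"
    unfolding d_def by (rule inv_m_right[OF conj_\<Delta>_unit])
  have "1 - d * conj_A u v l c s = 1 + pr * (- d * (u * c - l * v * s))"
    by (simp add: conj_A_def)
  then have "unit (1 - d * conj_A u v l c s)"
    using unit_1_pr by metis
  then have e: "[(1 - d * conj_A u v l c s) * e = 1] (mod m)"
    unfolding e_def by (rule inv_m_right)
  \<comment> \<open>Modulo p^q, \<delta> equals \<Delta> (1 - d A), with A the diagonal numerator;
    so dividing Z by its lower right entry produces exactly the denominators \<delta> of
    \<open>conj_eqI\<close>.\<close>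
  have \<delta>: "[\<delta> * (d * e) = 1] (mod m)"
    by (rule cong_combination2[OF e d, where c = 1 and c' = e]) (simp add: \<delta>_def algebra_simps)
  have L: "[\<delta> * ((1 + d * conj_A u v l c s) * e) = conj_\<Delta> u v l + conj_A u v l c s] (mod m)"
    by (rule cong_combination2[OF \<delta> d, where c = "conj_\<Delta> u v l + conj_A u v l c s" and c' = "- \<delta> * e"])
      (simp add: algebra_simps)
  have \<delta>_unit: "unit \<delta>"
    using unit_add_pr[of l "- u * v - (u * c - l * v * s)"] l
    by (simp add: \<delta>_def conj_defs algebra_simps)
  have "conj_\<Delta> u v l + conj_A u v l c s = l + pr * (- u * v + (u * c - l * v * s))"
    by (simp add: conj_defs algebra_simps)
  then have "unit ((1 + d * conj_A u v l c s) * e)"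
    using conj_diag_unit[OF l \<delta>_unit] L by metis
  moreover have "[\<delta> * (d * (c - pr * v ^ 2 * s) * e) = c - pr * v ^ 2 * s] (mod m)"
    by (rule cong_combination1[OF \<delta>, where c = "c - pr * v ^ 2 * s"]) (simp add: algebra_simps)
  moreover have "[\<delta> * (d * conj_B u l c s * e) = conj_B u l c s] (mod m)"
    by (rule cong_combination1[OF \<delta>, where c = "conj_B u l c s"]) (simp add: algebra_simps)
  ultimately have "M v u l \<otimes>\<^bsub>G\<^esub> X c s \<otimes>\<^bsub>G\<^esub> inv\<^bsub>G\<^esub> (M v u l)
      = M (d * (c - pr * v ^ 2 * s) * e) (d * conj_B u l c s * e) ((1 + d * conj_A u v l c s) * e)"
    using l L unfolding \<delta>_def conj_\<Delta>_def conj_A_def conj_B_def by (intro conj_eqI)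
  \<comment> \<open>The factor p^r of C is explicit, so the integer division in
    \<open>proj_elt\<close> is exact.\<close>
  moreover have "d * conj_C v c s div pr = d * (c - pr * v ^ 2 * s)"
    using pr_gt_1 by (simp add: conj_C_def mult.left_commute[of d])
  ultimately show ?thesis
    unfolding proj_elt_def Let_def conj_Z_index by (simp flip: d_def e_def)
qed

end

section \<open>Ideals and residual groups\<close>

abbreviation R where "R \<equiv> Rq p q"
abbreviation I :: "nat \<Rightarrow> int set" where "I \<equiv> ppow_ideal p q"
abbreviation pt :: "nat \<Rightarrow> int \<Rightarrow> int set" where "pt \<equiv> resid_pt p r q"
abbreviation Res :: "nat \<Rightarrow> int set monoid" where "Res \<equiv> resid p r q"

lemma carrier_R: "carrier R = {0..<m}"
  by (auto simp: residue_ring_def)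

lemma Units_R: "Units R = {x \<in> {0..<m}. unit x}"
proof -
  interpret residues m R by (rule residues_q) simp
  have "\<not> unit 0" using p_gt_1 by simp
  then show ?thesis
    unfolding res_units_eq coprime_m_iff by (auto simp: le_less)
qed

text \<open>For k at most q, reduction modulo p^q preserves divisibility by p^k.\<close>

lemma I_eq:
  assumes "k \<le> q"
  shows "I k = {x \<in> {0..<m}. int p ^ k dvd x}"
proof (intro subset_antisym subsetI)
  fix x assume "x \<in> I k"
  then show "x \<in> {x \<in> {0..<m}. int p ^ k dvd x}"
    using assms by (auto simp: ppow_ideal_def dvd_mod_iff le_imp_power_dvd)
next
  fix x assume x: "x \<in> {x \<in> {0..<m}. int p ^ k dvd x}"
  then obtain y where y: "x = int p ^ k * y" by (auto elim: dvdE)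
  have pk: "0 < int p ^ k" by simp
  have "0 \<le> y" using x pk unfolding y by (simp add: zero_le_mult_iff)
  moreover have "y \<le> x" unfolding y using pk \<open>0 \<le> y\<close>
    by (metis int_one_le_iff_zero_less mult_le_cancel_right1 mult.commute linorder_not_le)
  ultimately have "y \<in> carrier R" using x by (simp add: carrier_R)
  moreover have "x = (int p ^ k * y) mod m" using x y by simp
  ultimately show "x \<in> I k" unfolding ppow_ideal_def by blast
qed

lemma card_I:
  assumes "k \<le> q"
  shows "card (I k) = p ^ (q - k)"
proof -
  have pk: "0 < int p ^ k" by simp
  have m: "m = int p ^ k * int p ^ (q - k)" using assms by (simp flip: power_add)
  have "I k = (\<lambda>y. int p ^ k * y) ` {0..<int p ^ (q - k)}"
  proof (intro subset_antisym subsetI)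
    fix x assume "x \<in> I k"
    then obtain y where y: "x = int p ^ k * y" "0 \<le> x" "x < m"
      by (auto simp: I_eq[OF assms] elim: dvdE)
    then have "0 \<le> y" "y < int p ^ (q - k)"
      using pk unfolding m by (simp_all add: zero_le_mult_iff)
    then show "x \<in> (\<lambda>y. int p ^ k * y) ` {0..<int p ^ (q - k)}" using y by auto
  next
    fix x assume "x \<in> (\<lambda>y. int p ^ k * y) ` {0..<int p ^ (q - k)}"
    then show "x \<in> I k" using pk by (auto simp: I_eq[OF assms] m)
  qed
  moreover have "inj_on (\<lambda>y. int p ^ k * y) {0..<int p ^ (q - k)}"
    by (auto intro!: inj_onI)
  ultimately show ?thesis
    by (simp add: card_image flip: of_nat_power)
qed

lemma card_Units_R: "card (Units R) = totient n"
proof -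
  interpret residues m R by (rule residues_q) simp
  show ?thesis using totient_eq by (simp add: nat_power_eq)
qed

text \<open>Since p^(k+r) divides p^q, a coset of the ideal is a full class modulo p^(k+r) among the
  least residues. Residual classes are handled through this congruence from here on.\<close>

lemma pt_eq:
  assumes "k + r \<le> q"
  shows "pt k x = {y \<in> {0..<m}. [y = int p ^ k * x] (mod int p ^ (k + r))}"
proof -
  have dvd: "int p ^ (k + r) dvd m" using assms by (rule le_imp_power_dvd)
  have pt: "pt k x = {(h + (int p ^ k * x) mod m) mod m | h. h \<in> I (k + r)}"
    by (auto simp: resid_pt_def r_coset_def residue_ring_def)
  show ?thesis unfolding pt
  proof (intro subset_antisym subsetI)
    fix y assume "y \<in> {(h + (int p ^ k * x) mod m) mod m | h. h \<in> I (k + r)}"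
    then obtain h where h: "h \<in> I (k + r)" "y = (h + (int p ^ k * x) mod m) mod m" by blast
    have "[y = h + int p ^ k * x] (mod m)" using h by (simp add: cong_def mod_simps)
    then have "[y = h + int p ^ k * x] (mod int p ^ (k + r))" using dvd cong_dvd_modulus by blast
    moreover have "[h = 0] (mod int p ^ (k + r))"
      using h(1) assms by (simp add: I_eq cong_0_iff)
    ultimately have "[y = int p ^ k * x] (mod int p ^ (k + r))"
      by (rule cong_combination2[where c = 1 and c' = 1]) simp
    then show "y \<in> {y \<in> {0..<m}. [y = int p ^ k * x] (mod int p ^ (k + r))}"
      using h(2) by simp
  next
    fix y assume y: "y \<in> {y \<in> {0..<m}. [y = int p ^ k * x] (mod int p ^ (k + r))}"
    define h where "h = (y - int p ^ k * x) mod m"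
    have "h \<in> I (k + r)"
      using y assms dvd by (simp add: I_eq h_def dvd_mod_iff cong_iff_dvd_diff)
    moreover have "y = (h + (int p ^ k * x) mod m) mod m"
      using y by (simp add: h_def mod_simps)
    ultimately show "y \<in> {(h + (int p ^ k * x) mod m) mod m | h. h \<in> I (k + r)}" by blast
  qed
qed

lemma cong_scale: "[int p ^ k * x = int p ^ k * y] (mod int p ^ (k + j)) \<longleftrightarrow> [x = y] (mod int p ^ j)"
proof -
  have "int p ^ (k + j) dvd int p ^ k * (x - y) \<longleftrightarrow> int p ^ j dvd (x - y)"
    by (simp add: power_add)
  then show ?thesis by (simp add: cong_iff_dvd_diff right_diff_distrib)
qed

lemma pt_self:
  assumes "k + r \<le> q"
  shows "(int p ^ k * x) mod m \<in> pt k x"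
proof -
  have "int p ^ (k + r) dvd m" using assms by (rule le_imp_power_dvd)
  then show ?thesis using assms by (simp add: pt_eq cong_def mod_mod_cancel)
qed

lemma pt_eq_iff:
  assumes "k + r \<le> q"
  shows "pt k x = pt k y \<longleftrightarrow> [x = y] (mod pr)"
proof
  assume "pt k x = pt k y"
  then have "(int p ^ k * x) mod m \<in> pt k y" using pt_self[OF assms, of x] by simp
  then have "[(int p ^ k * x) mod m = int p ^ k * y] (mod int p ^ (k + r))"
    using assms by (simp add: pt_eq)
  then have "[int p ^ k * x = int p ^ k * y] (mod int p ^ (k + r))"
    using le_imp_power_dvd[OF assms, of "int p"] by (simp add: cong_def mod_mod_cancel)
  then show "[x = y] (mod pr)" by (simp add: cong_scale)
next
  assume "[x = y] (mod pr)"
  then have "[int p ^ k * x = int p ^ k * y] (mod int p ^ (k + r))" by (simp add: cong_scale)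
  then show "pt k x = pt k y" using assms by (simp add: pt_eq cong_def)
qed

lemma carrier_Res:
  assumes "k + r \<le> q"
  shows "carrier (Res k) = range (pt k)"
proof -
  have *: "carrier (Res k) = (\<lambda>c. I (k + r) #>\<^bsub>add_monoid R\<^esub> c) ` I k"
    by (auto simp: resid_def FactGroup_def RCOSETS_def r_coset_def)
  show ?thesis unfolding *
  proof (intro subset_antisym subsetI)
    fix C assume "C \<in> (\<lambda>c. I (k + r) #>\<^bsub>add_monoid R\<^esub> c) ` I k"
    then obtain y where "C = I (k + r) #>\<^bsub>add_monoid R\<^esub> ((int p ^ k * y) mod m)"
      by (auto simp: ppow_ideal_def)
    then show "C \<in> range (pt k)" by (simp add: resid_pt_def)
  next
    fix C assume "C \<in> range (pt k)"
    then obtain x where "C = pt k x" by blast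
    then have "C = pt k (x mod m)"
      using assms pr_dvd_m by (simp add: pt_eq_iff cong_def mod_mod_cancel)
    moreover have "(int p ^ k * (x mod m)) mod m \<in> I k"
      unfolding ppow_ideal_def carrier_R by fastforce
    ultimately show "C \<in> (\<lambda>c. I (k + r) #>\<^bsub>add_monoid R\<^esub> c) ` I k"
      by (auto simp: resid_pt_def)
  qed
qed

lemma pt_in_Res: "k + r \<le> q \<Longrightarrow> pt k x \<in> carrier (Res k)"
  by (simp add: carrier_Res)

lemma pt_scale:
  assumes "k + r \<le> q" "c \<in> pt k x"
  shows "(j * c) mod m \<in> pt k (j * x)"
proof -
  have "[j * c = int p ^ k * (j * x)] (mod int p ^ (k + r))"
    using assms cong_scalar_left[of c "int p ^ k * x" "int p ^ (k + r)" j]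
    by (simp add: pt_eq mult.left_commute)
  then show ?thesis
    using assms(1) le_imp_power_dvd[OF assms(1), of "int p"]
    by (simp add: pt_eq cong_def mod_mod_cancel)
qed

lemma pt_dvd:
  assumes "k + r \<le> q" "c \<in> pt k x"
  shows "int p ^ k dvd c"
proof -
  have "[c = int p ^ k * x] (mod int p ^ k)"
    using assms cong_dvd_modulus[of c _ "int p ^ (k + r)" "int p ^ k"]
    by (simp add: pt_eq le_imp_power_dvd)
  then show ?thesis by (simp add: cong_dvd_iff)
qed

lemma pt_eqI:
  assumes "k + r \<le> q" "c \<in> pt k x" "c \<in> pt k y"
  shows "pt k x = pt k y"
proof -
  have "[int p ^ k * x = int p ^ k * y] (mod int p ^ (k + r))"
    using assms by (auto simp: pt_eq intro: cong_trans cong_sym)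
  then show ?thesis using assms(1) by (simp add: pt_eq_iff cong_scale)
qed

lemma cong_m_imp_pr: "[x = y] (mod m) \<Longrightarrow> [x = y] (mod pr)"
  using pr_dvd_m cong_dvd_modulus by blast

lemma inv_m_right_pr: "unit x \<Longrightarrow> [x * inv_m x = 1] (mod pr)"
  using inv_m_right cong_m_imp_pr by blast

lemma pt_mult:
  assumes "k + r \<le> q"
  shows "pt k x \<otimes>\<^bsub>Res k\<^esub> pt k y = pt k (x + y)"
proof -
  have dvd: "int p ^ (k + r) dvd m" using assms by (rule le_imp_power_dvd)
  have "pt k x \<otimes>\<^bsub>Res k\<^esub> pt k y = {(h + h') mod m | h h'. h \<in> pt k x \<and> h' \<in> pt k y}"
    by (auto simp: resid_def FactGroup_def set_mult_def residue_ring_def)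
  also have "\<dots> = pt k (x + y)"
  proof (intro subset_antisym subsetI)
    fix z assume "z \<in> {(h + h') mod m | h h'. h \<in> pt k x \<and> h' \<in> pt k y}"
    then obtain h h' where h: "h \<in> pt k x" "h' \<in> pt k y" "z = (h + h') mod m" by blast
    then have "[h + h' = int p ^ k * (x + y)] (mod int p ^ (k + r))"
      using assms by (simp add: pt_eq distrib_left cong_add)
    then show "z \<in> pt k (x + y)"
      using assms dvd h(3) by (simp add: pt_eq cong_def mod_mod_cancel)
  next
    fix z assume z: "z \<in> pt k (x + y)"
    define h where "h = (int p ^ k * x) mod m"
    define h' where "h' = (z - h) mod m"
    have h: "h \<in> pt k x" unfolding h_def using assms by (rule pt_self)
    have zc: "[z = int p ^ k * (x + y)] (mod int p ^ (k + r))"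
      "[h = int p ^ k * x] (mod int p ^ (k + r))"
      using z h assms by (simp_all add: pt_eq)
    have "[z - h = int p ^ k * y] (mod int p ^ (k + r))"
      using zc by (rule cong_combination2[where c = 1 and c' = "- 1"]) (simp add: algebra_simps)
    then have "h' \<in> pt k y"
      using assms dvd by (simp add: h'_def pt_eq cong_def mod_mod_cancel)
    moreover have "z = (h + h') mod m"
      using z assms by (simp add: h'_def mod_simps pt_eq)
    ultimately show "z \<in> {(h + h') mod m | h h'. h \<in> pt k x \<and> h' \<in> pt k y}"
      using h by blast
  qed
  finally show ?thesis .
qed

section \<open>Characters of the residual groups\<close>

text \<open>The character of \<open>Z/p^r\<close> that describes the residual pairing in coordinates.\<close>

definition E :: "int \<Rightarrow> complex" where
  "E t = chi (int p ^ (q - r) * t)"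

lemma m_eq: "m = int p ^ (q - r) * pr"
  using r_less_q by (simp flip: power_add)

lemma E_eq_iff: "E s = E t \<longleftrightarrow> [s = t] (mod pr)"
proof -
  have "(q - r) + r = q" using r_less_q by simp
  then show ?thesis
    using cong_scale[of "q - r" s t r] by (simp add: E_def chi_eq_iff)
qed

text \<open>On multiples of p^(q-r) the cross term of \<open>chi_mult\<close> contains p^r p^(q-r) =
  p^q and drops out.\<close>

lemma E_add: "E (s + t) = E s * E t"
proof -
  let ?c = "int p ^ (q - r)"
  have "?c * s + ?c * t + pr * (?c * s) * (?c * t) = ?c * (s + t) + m * (s * (?c * t))"
    unfolding m_eq by (simp add: algebra_simps)
  then have "[?c * (s + t) = ?c * s + ?c * t + pr * (?c * s) * (?c * t)] (mod m)"
    by (simp add: cong_iff_dvd_diff)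
  then show ?thesis
    by (simp add: E_def chi_mult chi_eq_iff)
qed

lemma E_0 [simp]: "E 0 = 1"
  by (simp add: E_def)

lemma E_nat_power: "E (s * int k) = E s ^ k"
  by (induction k) (simp_all add: E_add distrib_left)

lemma E_root: "E s ^ (p ^ r) = 1"
proof -
  have "E s ^ (p ^ r) = E (s * pr)" using E_nat_power[of s "p ^ r"] by simp
  also have "\<dots> = E 0" unfolding E_eq_iff by (simp add: cong_iff_dvd_diff)
  finally show ?thesis by simp
qed

text \<open>\<open>E\<close> is injective on p^r residues, its values are p^r-th roots of unity, and
  there are exactly p^r of those. No explicit exponential and no unit \<kappa> has to be
  named.\<close>

lemma E_surj:
  assumes "z ^ (p ^ r) = 1"
  obtains x where "0 \<le> x" "x < pr" "E x = z"
proof -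
  have "inj_on E {0..<pr}"
    by (auto intro!: inj_onI simp: E_eq_iff cong_def)
  then have "card (E ` {0..<pr}) = p ^ r"
    by (simp add: card_image flip: of_nat_power)
  moreover have "card {z::complex. z ^ (p ^ r) = 1} = p ^ r"
    by (rule card_roots_unity_eq) simp
  moreover have "finite {z::complex. z ^ (p ^ r) = 1}"
    using finite_roots_unity[of "p ^ r"] p_pos by (metis One_nat_def Suc_leI zero_less_power)
  ultimately have "E ` {0..<pr} = {z. z ^ (p ^ r) = 1}"
    by (intro card_subset_eq) (auto simp: E_root)
  then have "z \<in> E ` {0..<pr}" using assms by simp
  then show thesis using that by auto
qed

text \<open>The residual group is cyclic with generator \<open>pt k 1\<close>, so a homomorphism is
  fixed by its value there; that value is a root of unity and hence of the form
  \<open>E x\<close>.\<close>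

lemma hom_Res_mu:
  assumes k: "k + r \<le> q" and \<psi>: "\<psi> \<in> hom (Res k) (mu (p ^ r))"
  obtains x where "\<And>y. \<psi> (pt k y) = E (x * y)"
proof -
  have root: "\<psi> (pt k y) ^ (p ^ r) = 1" for y
    using hom_in_carrier[OF \<psi> pt_in_Res[OF k]] by (simp add: mu_def complex_mult_on_def)
  have add: "\<psi> (pt k (x + y)) = \<psi> (pt k x) * \<psi> (pt k y)" for x y
    using hom_mult[OF \<psi> pt_in_Res[OF k, of x] pt_in_Res[OF k, of y]]
    by (simp add: pt_mult[OF k] mu_def complex_mult_on_def)
  \<comment> \<open>The value at 0 is idempotent, and 0 is no p^r-th root of unity; hence it is
    1.\<close>
  have "\<psi> (pt k 0) \<noteq> 0" using root[of 0] by (auto simp: power_0_left split: if_splits)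
  then have zero: "\<psi> (pt k 0) = 1" using add[of 0 0] by simp
  obtain x where x: "E x = \<psi> (pt k 1)" using E_surj[OF root[of 1]] by metis
  have nat: "\<psi> (pt k (int j)) = E (x * int j)" for j
    by (induction j) (simp_all add: zero add x[symmetric] E_add distrib_left)
  have "\<psi> (pt k y) = E (x * y)" for y
  proof -
    have "0 \<le> y mod pr" using pr_gt_1 by simp
    then obtain j where j: "y mod pr = int j" by (metis zero_le_imp_eq_int)
    have "pt k y = pt k (int j)" using k by (simp add: pt_eq_iff cong_def flip: j)
    moreover have "E (x * y) = E (x * int j)"
      by (simp add: E_eq_iff cong_def mod_simps flip: j)
    ultimately show ?thesis using nat by simp
  qed
  then show thesis using that by blast
qed

section \<open>Windows with arbitrary integer parameters\<close>

lemma unit_mod: "unit (l mod m) \<longleftrightarrow> unit l"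
  by (rule unit_cong[OF cong_m_imp_p]) (simp add: cong_def)

lemma M_mod: "unit l \<Longrightarrow> M (v mod m) (u mod m) (l mod m) = M v u l"
  by (subst M_eq_iff) (simp_all add: unit_mod cong_def)

lemma X_mod: "X (c mod m) (s mod m) = X c s"
  using M_mod[of 1 c s] m_gt_1 by (simp add: X_elt_def)

lemma mod_in_I: "k \<le> q \<Longrightarrow> int p ^ k dvd x \<Longrightarrow> x mod m \<in> I k"
  by (simp add: I_eq dvd_mod_iff le_imp_power_dvd)

text \<open>Removes least residues from the parameters, so that products and conjugates need no
  reduction afterwards.\<close>

lemma window_eq:
  assumes "\<alpha> \<le> q" "\<beta> \<le> q"
  shows "window p r q \<chi> \<alpha> \<beta> = {X c s | c s. int p ^ \<alpha> dvd c \<and> int p ^ \<beta> dvd s}"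
proof (intro subset_antisym subsetI)
  fix x assume "x \<in> window p r q \<chi> \<alpha> \<beta>"
  then show "x \<in> {X c s | c s. int p ^ \<alpha> dvd c \<and> int p ^ \<beta> dvd s}"
    using assms by (auto simp: window_def I_eq)
next
  fix x assume "x \<in> {X c s | c s. int p ^ \<alpha> dvd c \<and> int p ^ \<beta> dvd s}"
  then obtain c s where "int p ^ \<alpha> dvd c" "int p ^ \<beta> dvd s" "x = X c s" by blast
  then have "x = X (c mod m) (s mod m)" "c mod m \<in> I \<alpha>" "s mod m \<in> I \<beta>"
    using assms by (simp_all add: X_mod mod_in_I)
  then show "x \<in> window p r q \<chi> \<alpha> \<beta>"
    unfolding window_def by blast
qed

end

section \<open>Normalizer, nonconjugacy and order\<close>

locale maximal_polarization = polarized +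
  fixes \<alpha> \<beta> :: nat
  assumes sum: "\<alpha> + \<beta> = q - r"
begin

abbreviation pa :: int where "pa \<equiv> int p ^ \<alpha>"
abbreviation pb :: int where "pb \<equiv> int p ^ \<beta>"
abbreviation W where "W \<equiv> window p r q \<chi> \<alpha> \<beta>"
abbreviation N where
  "N \<equiv> {M v u l | v u l. v \<in> ppow_ideal p q \<alpha> \<and> u \<in> ppow_ideal p q \<beta> \<and> l \<in> Units R}"
abbreviation A where "A \<equiv> Res \<alpha>"
abbreviation B where "B \<equiv> Res \<beta>"
abbreviation Q where "Q \<equiv> G\<lparr>carrier := N\<rparr> Mod W"

lemma le_q: "\<alpha> \<le> q" "\<beta> \<le> q" "\<alpha> + r \<le> q" "\<beta> + r \<le> q"
  using sum r_less_q by auto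

lemma m_split: "m = pa * pb * pr"
proof -
  have "q = \<alpha> + \<beta> + r" using sum r_less_q by simp
  then show ?thesis by (simp add: power_add)
qed

text \<open>The place where the exponents are balanced: p^\<alpha> p^\<beta> p^r = p^q, so the
  window parameters are orthogonal modulo p^q.\<close>

lemma m_dvd: "pa dvd v \<Longrightarrow> pb dvd u \<Longrightarrow> m dvd pr * v * u"
  by (auto simp: m_split elim!: dvdE)

lemma W_eq: "W = {X c s | c s. pa dvd c \<and> pb dvd s}"
  by (rule window_eq) (rule le_q)+

lemma N_eq: "N = {M v u l | v u l. pa dvd v \<and> pb dvd u \<and> unit l}"
proof (intro subset_antisym subsetI)
  fix x assume "x \<in> N"
  then show "x \<in> {M v u l | v u l. pa dvd v \<and> pb dvd u \<and> unit l}"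
    using le_q by (auto simp: I_eq Units_R)
next
  fix x assume "x \<in> {M v u l | v u l. pa dvd v \<and> pb dvd u \<and> unit l}"
  then obtain v u l where *: "pa dvd v" "pb dvd u" "unit l" "x = M v u l" by blast
  then have "x = M (v mod m) (u mod m) (l mod m)" by (simp add: M_mod)
  moreover have "v mod m \<in> I \<alpha>" "u mod m \<in> I \<beta>" "l mod m \<in> Units R"
    using * le_q by (simp_all add: mod_in_I Units_R unit_mod)
  ultimately show "x \<in> N" by blast
qed

text \<open>By \<open>m_dvd\<close> the normalizing factor is 1 and the term p^r u v' vanishes. In
  this form \<lambda> is multiplicative and the elements with \<lambda> = 1 commute, which exhibits
  N as a semidirect product.\<close>

lemma N_mult:
  assumes "pa dvd v" "pb dvd u" "unit l" "pa dvd v'" "pb dvd u'" "unit l'"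
  shows "M v u l \<otimes>\<^bsub>G\<^esub> M v' u' l' = M (v * l' + v') (l * u' + u) (l * l')"
proof (rule M_mult)
  have "[pr * v * u' = 0] (mod m)" "[pr * v' * u = 0] (mod m)"
    using assms by (simp_all add: cong_0_iff m_dvd)
  then have "[(1 + pr * v * u') * x = x] (mod m)"
    "[(1 + pr * v * u') * (l * l') = l * l' + pr * u * v'] (mod m)" for x
    by (auto intro: cong_combination1[where c = x] cong_combination2[where c = "l * l'" and c' = "- 1"]
        simp: algebra_simps)
  then show "prod_rel (v, u, l) (v', u', l') (v * l' + v', l * u' + u, l * l')"
    by (simp add: prod_rel_def)
qed (use assms in auto)

lemma N_in_G: "N \<subseteq> carrier G"
  by (auto simp: N_eq M_in_G)

lemma W_in_N: "W \<subseteq> N"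
  unfolding W_eq N_eq X_elt_def by fastforce

lemma W_in_G: "W \<subseteq> carrier G"
  using W_in_N N_in_G by blast

lemma N_conj:
  assumes "pa dvd v" "pb dvd u" "unit l" "pa dvd c" "pb dvd s"
  shows "M v u l \<otimes>\<^bsub>G\<^esub> X c s \<otimes>\<^bsub>G\<^esub> inv\<^bsub>G\<^esub> (M v u l) = X (inv_m l * c) (l * s)"
proof -
  interpret G: group G by (rule group_G)
  have "M (inv_m l * c) (l * s) 1 \<otimes>\<^bsub>G\<^esub> M v u l = M (inv_m l * c * l + v) (u + l * s) l"
    using N_mult[of "inv_m l * c" "l * s" 1 v u l] assms by simp
  also have "\<dots> = M (v + c) (l * s + u) l"
  proof -
    have "[inv_m l * c * l + v = v + c] (mod m)"
      by (rule cong_combination1[OF inv_m_right[OF assms(3)], where c = c]) (simp add: algebra_simps)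
    then show ?thesis
      using assms(3) by (simp add: M_eq_iff add.commute)
  qed
  also have "\<dots> = M v u l \<otimes>\<^bsub>G\<^esub> X c s"
    using N_mult[of v u l c s 1] assms by (simp add: X_elt_def)
  finally have "X (inv_m l * c) (l * s) \<otimes>\<^bsub>G\<^esub> M v u l = M v u l \<otimes>\<^bsub>G\<^esub> X c s"
    by (simp add: X_elt_def)
  moreover have "X (inv_m l * c) (l * s) \<in> carrier G" "M v u l \<in> carrier G" "X c s \<in> carrier G"
    using assms by (simp_all add: M_in_G X_elt_def)
  ultimately show ?thesis
    by (metis G.inv_closed G.m_assoc G.r_inv G.r_one)
qed

lemma conj_W_imp_N:
  assumes g: "g \<in> carrier G"
    and conj: "\<And>w. w \<in> W \<Longrightarrow> \<exists>c s. g \<otimes>\<^bsub>G\<^esub> w \<otimes>\<^bsub>G\<^esub> inv\<^bsub>G\<^esub> g = X c s"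
  shows "g \<in> N"
proof -
  obtain v u l where g: "g = M v u l" "unit l" using g by (auto simp: carrier_G)
  have X: "m dvd pr * (u * c - l * v * s)" if "pa dvd c" "pb dvd s" for c s
  proof -
    have "X c s \<in> W" using that unfolding W_eq by blast
    then show ?thesis using conj conj_is_X_imp[OF g(2)] unfolding g(1) by blast
  qed
  have pos: "pr \<noteq> 0" "pa \<noteq> 0" "pb \<noteq> 0" by simp_all
  \<comment> \<open>The relation \<open>X\<close> for the generator (p^\<alpha>, 0): cancelling
    p^\<alpha> p^r from p^q leaves p^\<beta>.\<close>
  have "pa * (pb * pr) dvd pa * (u * pr)"
    using X[of pa 0] by (simp add: m_split ac_simps)
  then have "pb dvd u" using pos by simp
  have "pb * (pa * pr) dvd pb * (- (l * v) * pr)"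
    using X[of 0 pb] by (simp add: m_split ac_simps)
  then have "pa dvd l * v" using pos by simp
  moreover have "coprime pa l" using g(2) by (simp add: coprime_commute)
  ultimately have "pa dvd v" by (simp add: coprime_dvd_mult_right_iff)
  then show ?thesis using g \<open>pb dvd u\<close> unfolding N_eq by blast
qed

lemma conj_coset_eq: "g <#\<^bsub>G\<^esub> V #>\<^bsub>G\<^esub> h = {g \<otimes>\<^bsub>G\<^esub> w \<otimes>\<^bsub>G\<^esub> h | w. w \<in> V}"
  by (auto simp: l_coset_def r_coset_def)

lemma N_conj_W:
  assumes "g \<in> N"
  shows "g <#\<^bsub>G\<^esub> W #>\<^bsub>G\<^esub> inv\<^bsub>G\<^esub> g = W"
proof -
  obtain v u l where g: "g = M v u l" "pa dvd v" "pb dvd u" "unit l"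
    using assms unfolding N_eq by blast
  have conj: "g \<otimes>\<^bsub>G\<^esub> X c s \<otimes>\<^bsub>G\<^esub> inv\<^bsub>G\<^esub> g = X (inv_m l * c) (l * s)"
    if "pa dvd c" "pb dvd s" for c s
    unfolding g(1) using N_conj[OF g(2-4) that] .
  have "{g \<otimes>\<^bsub>G\<^esub> w \<otimes>\<^bsub>G\<^esub> inv\<^bsub>G\<^esub> g | w. w \<in> W}
      = {g \<otimes>\<^bsub>G\<^esub> X c s \<otimes>\<^bsub>G\<^esub> inv\<^bsub>G\<^esub> g | c s. pa dvd c \<and> pb dvd s}"
    unfolding W_eq by blast
  also have "\<dots> = {X (inv_m l * c) (l * s) | c s. pa dvd c \<and> pb dvd s}"
    using conj by (intro Collect_cong) metis
  also have "\<dots> = W"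
    unfolding W_eq
  proof (intro subset_antisym subsetI)
    fix x assume "x \<in> {X c s | c s. pa dvd c \<and> pb dvd s}"
    then obtain c s where x: "x = X c s" "pa dvd c" "pb dvd s" by blast
    \<comment> \<open>The pair (l c, l^-1 s) is the preimage of (c, s) under the conjugation map (c,
      s) -> (l^-1 c, l s).\<close>
    have "[c = inv_m l * (l * c)] (mod m)" "[s = l * (inv_m l * s)] (mod m)"
      by (rule cong_combination1[OF inv_m_right[OF g(4)], where c = "- c"], simp add: algebra_simps)
        (rule cong_combination1[OF inv_m_right[OF g(4)], where c = "- s"], simp add: algebra_simps)
    then have "X c s = X (inv_m l * (l * c)) (l * (inv_m l * s))"
      by (simp add: X_elt_def M_eq_iff)
    moreover have "pa dvd l * c" "pb dvd inv_m l * s" using x by simp_all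
    ultimately show "x \<in> {X (inv_m l * c) (l * s) | c s. pa dvd c \<and> pb dvd s}"
      using x(1) by blast
  qed force
  finally show ?thesis unfolding conj_coset_eq .
qed

lemma normalizer_W: "normalizer G W = N"
proof -
  have "normalizer G W = {g \<in> carrier G. g <#\<^bsub>G\<^esub> W #>\<^bsub>G\<^esub> inv\<^bsub>G\<^esub> g = W}"
    using W_in_G by (simp add: normalizer_def stabilizer_def)
  also have "\<dots> = N"
  proof (intro subset_antisym subsetI)
    fix g assume g: "g \<in> {g \<in> carrier G. g <#\<^bsub>G\<^esub> W #>\<^bsub>G\<^esub> inv\<^bsub>G\<^esub> g = W}"
    show "g \<in> N"
    proof (rule conj_W_imp_N)
      fix w assume "w \<in> W"
      then have "g \<otimes>\<^bsub>G\<^esub> w \<otimes>\<^bsub>G\<^esub> inv\<^bsub>G\<^esub> g \<in> W" using g unfolding conj_coset_eq by blast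
      then show "\<exists>c s. g \<otimes>\<^bsub>G\<^esub> w \<otimes>\<^bsub>G\<^esub> inv\<^bsub>G\<^esub> g = X c s" unfolding W_eq by blast
    qed (use g in simp)
  qed (use N_conj_W N_in_G in blast)
  finally show ?thesis .
qed

lemma windows_not_conj:
  assumes "\<alpha>' + \<beta>' = q - r" "(\<alpha>', \<beta>') \<noteq> (\<alpha>, \<beta>)" "g \<in> carrier G"
  shows "g <#\<^bsub>G\<^esub> W #>\<^bsub>G\<^esub> inv\<^bsub>G\<^esub> g \<noteq> window p r q \<chi> \<alpha>' \<beta>'"
proof
  assume eq: "g <#\<^bsub>G\<^esub> W #>\<^bsub>G\<^esub> inv\<^bsub>G\<^esub> g = window p r q \<chi> \<alpha>' \<beta>'"
  have le: "\<alpha>' \<le> q" "\<beta>' \<le> q" using assms by auto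
  have W': "window p r q \<chi> \<alpha>' \<beta>' = {X c s | c s. int p ^ \<alpha>' dvd c \<and> int p ^ \<beta>' dvd s}"
    using le by (rule window_eq)
  have "g \<in> N"
  proof (rule conj_W_imp_N[OF assms(3)])
    fix w assume "w \<in> W"
    then have "g \<otimes>\<^bsub>G\<^esub> w \<otimes>\<^bsub>G\<^esub> inv\<^bsub>G\<^esub> g \<in> window p r q \<chi> \<alpha>' \<beta>'"
      using eq unfolding conj_coset_eq by blast
    then show "\<exists>c s. g \<otimes>\<^bsub>G\<^esub> w \<otimes>\<^bsub>G\<^esub> inv\<^bsub>G\<^esub> g = X c s" unfolding W' by blast
  qed
  then have WW: "W = {X c s | c s. int p ^ \<alpha>' dvd c \<and> int p ^ \<beta>' dvd s}"
    using N_conj_W eq W' by simp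
  have dvd: "int p ^ \<alpha>' dvd c \<and> int p ^ \<beta>' dvd s" if "pa dvd c" "pb dvd s" for c s
  proof -
    have "X c s \<in> W" using that unfolding W_eq by blast
    then obtain c' s' where *: "X c s = X c' s'" "int p ^ \<alpha>' dvd c'" "int p ^ \<beta>' dvd s'"
      unfolding WW by blast
    then have "[c = c'] (mod m)" "[s = s'] (mod m)" by (simp_all add: X_elt_def M_eq_iff)
    then show ?thesis
      using * le by (meson cong_dvd_iff cong_dvd_modulus le_imp_power_dvd)
  qed
  \<comment> \<open>One inclusion is enough: both pairs have sum q - r, so two inequalities in the
    same direction force equality.\<close>
  have "\<alpha>' \<le> \<alpha>" "\<beta>' \<le> \<beta>"
  proof -
    have "p ^ \<alpha>' dvd p ^ \<alpha>" "p ^ \<beta>' dvd p ^ \<beta>"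
      using dvd[of pa pb] by (simp_all flip: of_nat_power)
    then show "\<alpha>' \<le> \<alpha>" "\<beta>' \<le> \<beta>" using p_gt_1 by (simp_all add: power_dvd_imp_le)
  qed
  then show False using assms sum by auto
qed

lemma card_N: "card N = p ^ (q + r) * totient n"
proof -
  let ?T = "I \<alpha> \<times> I \<beta> \<times> Units R"
  have "N = (\<lambda>(v, u, l). M v u l) ` ?T" by force
  moreover have "inj_on (\<lambda>(v, u, l). M v u l) ?T"
  proof (rule inj_onI)
    fix x y assume "x \<in> ?T" "y \<in> ?T" and eq: "(\<lambda>(v, u, l). M v u l) x = (\<lambda>(v, u, l). M v u l) y"
    then obtain v u l v' u' l' where xy: "x = (v, u, l)" "y = (v', u', l')"
      and *: "v \<in> I \<alpha>" "u \<in> I \<beta>" "l \<in> Units R" "v' \<in> I \<alpha>" "u' \<in> I \<beta>" "l' \<in> Units R"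
      by auto
    then have "[v = v'] (mod m) \<and> [u = u'] (mod m) \<and> [l = l'] (mod m)"
      using eq by (simp add: M_eq_iff Units_R)
    then show "x = y"
      using * le_q xy by (simp add: I_eq Units_R cong_def)
  qed
  ultimately have "card N = p ^ (q - \<alpha>) * (p ^ (q - \<beta>) * totient n)"
    using le_q by (simp add: card_image card_cartesian_product card_I card_Units_R)
  moreover have "q - \<alpha> + (q - \<beta>) = q + r" using sum r_less_q by simp
  ultimately show ?thesis by (simp flip: power_add mult.assoc)
qed

section \<open>The quotient of the normalizer\<close>

lemma N_subgroup: "subgroup N G"
  using group.normalizer_imp_subgroup[OF group_G W_in_G] by (simp only: normalizer_W)

lemma W_subgroup: "subgroup W G"
proof -
  interpret G: group G by (rule group_G)
  have X_mult: "X c s \<otimes>\<^bsub>G\<^esub> X c' s' = X (c + c') (s' + s)"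
    if "pa dvd c" "pb dvd s" "pa dvd c'" "pb dvd s'" for c s c' s'
    using N_mult[of c s 1 c' s' 1] that by (simp add: X_elt_def)
  show ?thesis
  proof (rule G.subgroupI)
    show "W \<subseteq> carrier G" by (rule W_in_G)
    have "X 0 0 \<in> W" unfolding W_eq by fastforce
    then show "W \<noteq> {}" by blast
  next
    fix x assume "x \<in> W"
    then obtain c s where x: "x = X c s" "pa dvd c" "pb dvd s" unfolding W_eq by blast
    have "X (- c) (- s) \<otimes>\<^bsub>G\<^esub> X c s = \<one>\<^bsub>G\<^esub>"
      using X_mult[of "- c" "- s" c s] x by (simp add: one_G X_elt_def)
    then have "inv\<^bsub>G\<^esub> x = X (- c) (- s)"
      using x(1) by (intro G.inv_equality) (simp_all add: X_elt_def M_in_G)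
    moreover have "pa dvd - c" "pb dvd - s" using x by simp_all
    ultimately show "inv\<^bsub>G\<^esub> x \<in> W" unfolding W_eq by blast
  next
    fix x y assume "x \<in> W" "y \<in> W"
    then obtain c s c' s' where x: "x = X c s" "pa dvd c" "pb dvd s"
      and y: "y = X c' s'" "pa dvd c'" "pb dvd s'" unfolding W_eq by blast
    then have "x \<otimes>\<^bsub>G\<^esub> y = X (c + c') (s' + s)" "pa dvd c + c'" "pb dvd s' + s"
      by (simp_all add: X_mult)
    then show "x \<otimes>\<^bsub>G\<^esub> y \<in> W" unfolding W_eq by blast
  qed
qed

lemma W_normal: "W \<lhd> G\<lparr>carrier := N\<rparr>"
proof -
  interpret G: group G by (rule group_G)
  interpret GN: group "G\<lparr>carrier := N\<rparr>"
    by (rule G.subgroup_imp_group[OF N_subgroup])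
  show ?thesis
  proof (rule GN.normal_invI)
    show "subgroup W (G\<lparr>carrier := N\<rparr>)"
      by (rule G.subgroup_incl[OF W_subgroup N_subgroup W_in_N])
  next
    fix x h assume x: "x \<in> carrier (G\<lparr>carrier := N\<rparr>)" and h: "h \<in> W"
    then have "x \<in> N" by simp
    have "x \<otimes>\<^bsub>G\<^esub> h \<otimes>\<^bsub>G\<^esub> inv\<^bsub>G\<^esub> x \<in> W"
      using N_conj_W[OF \<open>x \<in> N\<close>] h unfolding conj_coset_eq by blast
    then show "x \<otimes>\<^bsub>G\<lparr>carrier := N\<rparr>\<^esub> h \<otimes>\<^bsub>G\<lparr>carrier := N\<rparr>\<^esub> inv\<^bsub>G\<lparr>carrier := N\<rparr>\<^esub> x \<in> W"
      using G.m_inv_consistent[OF N_subgroup \<open>x \<in> N\<close>] by simp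
  qed
qed

text \<open>A coset of the window in its normalizer remembers only \<lambda>; integer labels let the
  quotient be computed by congruences.\<close>

definition diag_coset :: "int \<Rightarrow> (complex mat \<times> complex mat) set set" where
  "diag_coset l = {M v u l | v u. pa dvd v \<and> pb dvd u}"

lemma W_coset:
  assumes "pa dvd v" "pb dvd u" "unit l"
  shows "W #>\<^bsub>G\<^esub> M v u l = diag_coset l"
proof -
  have mult: "X c s \<otimes>\<^bsub>G\<^esub> M v u l = M (c * l + v) (u + s) l" if "pa dvd c" "pb dvd s" for c s
    using N_mult[of c s 1 v u l] that assms by (simp add: X_elt_def)
  have "W #>\<^bsub>G\<^esub> M v u l = {X c s \<otimes>\<^bsub>G\<^esub> M v u l | c s. pa dvd c \<and> pb dvd s}"
    unfolding W_eq r_coset_def by blast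
  also have "\<dots> = diag_coset l"
  proof (intro subset_antisym subsetI)
    fix x assume "x \<in> {X c s \<otimes>\<^bsub>G\<^esub> M v u l | c s. pa dvd c \<and> pb dvd s}"
    then obtain c s where "x = M (c * l + v) (u + s) l" "pa dvd c" "pb dvd s"
      using mult by blast
    moreover from this have "pa dvd c * l + v" "pb dvd u + s" using assms by simp_all
    ultimately show "x \<in> diag_coset l" unfolding diag_coset_def by blast
  next
    fix x assume "x \<in> diag_coset l"
    then obtain v' u' where x: "x = M v' u' l" "pa dvd v'" "pb dvd u'" unfolding diag_coset_def by blast
    \<comment> \<open>The solution of c l + v = v', since multiplying on the left by X(c, s) sends v
      to c l + v.\<close>
    define c where "c = (v' - v) * inv_m l"
    have "[v' = c * l + v] (mod m)"
      by (rule cong_combination1[OF inv_m_right[OF assms(3)], where c = "- (v' - v)"])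
        (simp add: c_def algebra_simps)
    then have "x = M (c * l + v) (u + (u' - u)) l"
      unfolding x(1) using assms(3) by (simp add: M_eq_iff)
    moreover have "pa dvd c" "pb dvd u' - u" using x assms by (simp_all add: c_def)
    ultimately show "x \<in> {X c s \<otimes>\<^bsub>G\<^esub> M v u l | c s. pa dvd c \<and> pb dvd s}"
      using mult by (metis (mono_tags, lifting) mem_Collect_eq)
  qed
  finally show ?thesis .
qed

lemma diag_coset_eq_iff:
  assumes "unit l" "unit l'"
  shows "diag_coset l = diag_coset l' \<longleftrightarrow> [l = l'] (mod m)"
proof
  assume eq: "diag_coset l = diag_coset l'"
  have "M 0 0 l \<in> diag_coset l" unfolding diag_coset_def by fastforce
  then have "M 0 0 l \<in> diag_coset l'" by (simp only: eq)
  then obtain v u where "M 0 0 l = M v u l'" unfolding diag_coset_def by blast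
  then show "[l = l'] (mod m)" using assms by (simp add: M_eq_iff)
next
  assume "[l = l'] (mod m)"
  then have "M v u l = M v u l'" for v u using assms by (simp add: M_eq_iff)
  then show "diag_coset l = diag_coset l'" by (simp add: diag_coset_def)
qed

lemma carrier_Q: "carrier Q = {diag_coset l | l. unit l}"
proof -
  have "carrier Q = {W #>\<^bsub>G\<^esub> x | x. x \<in> N}"
    by (auto simp: FactGroup_def RCOSETS_def r_coset_def)
  also have "\<dots> = {diag_coset l | l. unit l}"
  proof (intro subset_antisym subsetI)
    fix K assume "K \<in> {W #>\<^bsub>G\<^esub> x | x. x \<in> N}"
    then show "K \<in> {diag_coset l | l. unit l}"
      unfolding N_eq using W_coset by blast
  next
    fix K assume "K \<in> {diag_coset l | l. unit l}"
    then obtain l where "unit l" "K = W #>\<^bsub>G\<^esub> M 0 0 l" using W_coset[of 0 0] by fastforce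
    moreover have "M 0 0 l \<in> N" unfolding N_eq using \<open>unit l\<close> by fastforce
    ultimately show "K \<in> {W #>\<^bsub>G\<^esub> x | x. x \<in> N}" by blast
  qed
  finally show ?thesis .
qed

lemma diag_coset_in_Q: "unit l \<Longrightarrow> diag_coset l \<in> carrier Q"
  unfolding carrier_Q by blast

lemma group_Q: "group Q"
  using W_normal by (rule normal.factorgroup_is_group)

lemma diag_coset_mult:
  assumes "unit l" "unit l'"
  shows "diag_coset l \<otimes>\<^bsub>Q\<^esub> diag_coset l' = diag_coset (l * l')"
proof -
  have coset: "W #>\<^bsub>G\<lparr>carrier := N\<rparr>\<^esub> x = W #>\<^bsub>G\<^esub> x" for x
    by (simp add: r_coset_def)
  have N: "M 0 0 k \<in> N" if "unit k" for k
    unfolding N_eq using that by fastforce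
  have "diag_coset l \<otimes>\<^bsub>Q\<^esub> diag_coset l' = W #>\<^bsub>G\<^esub> (M 0 0 l \<otimes>\<^bsub>G\<^esub> M 0 0 l')"
    using normal.rcos_sum[OF W_normal, of "M 0 0 l" "M 0 0 l'"] assms N
    by (simp add: W_coset coset)
  also have "M 0 0 l \<otimes>\<^bsub>G\<^esub> M 0 0 l' = M 0 0 (l * l')"
    using N_mult[of 0 0 l 0 0 l'] assms by simp
  finally show ?thesis using assms by (simp add: W_coset)
qed

section \<open>The residual action\<close>

abbreviation act where "act \<equiv> resid_act p r q \<chi> \<alpha> \<beta>"
abbreviation T where "T \<equiv> carrier A \<times> carrier B"

text \<open>Existence: by \<open>N_conj\<close> the new parameters depend on \<lambda> alone and not
  on the representative of the coset. Uniqueness: conjugating a single sample point by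
  \<open>M 0 0 l\<close> already puts an element of the expected class into each component of
  \<open>D\<close>, and classes that meet are equal.\<close>

lemma act_diag_coset:
  assumes "unit l"
  shows "act (diag_coset l) (pt \<alpha> x, pt \<beta> y) = (pt \<alpha> (inv_m l * x), pt \<beta> (l * y))"
proof -
  let ?P = "\<lambda>D. D \<in> T \<and> (\<forall>m\<in>diag_coset l. \<forall>c\<in>pt \<alpha> x. \<forall>s\<in>pt \<beta> y. \<exists>c'\<in>fst D. \<exists>s'\<in>snd D.
     m \<otimes>\<^bsub>G\<^esub> X c s \<otimes>\<^bsub>G\<^esub> inv\<^bsub>G\<^esub> m = X c' s')"
  have conj: "g \<otimes>\<^bsub>G\<^esub> X c s \<otimes>\<^bsub>G\<^esub> inv\<^bsub>G\<^esub> g = X ((inv_m l * c) mod m) ((l * s) mod m)"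
    if g: "g \<in> diag_coset l" and cs: "c \<in> pt \<alpha> x" "s \<in> pt \<beta> y" for g c s
  proof -
    obtain v u where "g = M v u l" "pa dvd v" "pb dvd u" using g unfolding diag_coset_def by blast
    then show ?thesis
      using N_conj assms pt_dvd[OF le_q(3) cs(1)] pt_dvd[OF le_q(4) cs(2)] by (simp add: X_mod)
  qed
  have "act (diag_coset l) (pt \<alpha> x, pt \<beta> y) = (THE D. ?P D)"
    using le_q by (simp add: resid_act_def pt_in_Res)
  also have "\<dots> = (pt \<alpha> (inv_m l * x), pt \<beta> (l * y))"
  proof (rule the_equality)
    show "?P (pt \<alpha> (inv_m l * x), pt \<beta> (l * y))"
    proof (intro conjI ballI)
      show "(pt \<alpha> (inv_m l * x), pt \<beta> (l * y)) \<in> T" using le_q by (simp add: pt_in_Res)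
      fix g c s assume "g \<in> diag_coset l" "c \<in> pt \<alpha> x" "s \<in> pt \<beta> y"
      then show "\<exists>c'\<in>fst (pt \<alpha> (inv_m l * x), pt \<beta> (l * y)).
          \<exists>s'\<in>snd (pt \<alpha> (inv_m l * x), pt \<beta> (l * y)).
            g \<otimes>\<^bsub>G\<^esub> X c s \<otimes>\<^bsub>G\<^esub> inv\<^bsub>G\<^esub> g = X c' s'"
        unfolding fst_conv snd_conv using conj pt_scale le_q(3,4) by blast
    qed
  next
    fix D assume D: "?P D"
    then obtain x' y' where D_eq: "D = (pt \<alpha> x', pt \<beta> y')"
      using le_q by (cases D) (auto simp: carrier_Res)
    define c s where "c = (pa * x) mod m" and "s = (pb * y) mod m"
    have c: "c \<in> pt \<alpha> x" and s: "s \<in> pt \<beta> y"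
      unfolding c_def s_def using le_q by (simp_all add: pt_self)
    have g: "M 0 0 l \<in> diag_coset l" unfolding diag_coset_def by fastforce
    have "\<exists>c'\<in>fst D. \<exists>s'\<in>snd D. M 0 0 l \<otimes>\<^bsub>G\<^esub> X c s \<otimes>\<^bsub>G\<^esub> inv\<^bsub>G\<^esub> (M 0 0 l) = X c' s'"
      using D g c s by blast
    then obtain c' s' where *: "c' \<in> pt \<alpha> x'" "s' \<in> pt \<beta> y'"
      "X ((inv_m l * c) mod m) ((l * s) mod m) = X c' s'"
      unfolding conj[OF g c s] D_eq fst_conv snd_conv by blast
    then have "(inv_m l * c) mod m = c'" "(l * s) mod m = s'"
      using le_q by (simp_all add: X_elt_def M_eq_iff pt_eq cong_def)
    then have "c' \<in> pt \<alpha> (inv_m l * x)" "s' \<in> pt \<beta> (l * y)"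
      using pt_scale[OF le_q(3) c] pt_scale[OF le_q(4) s] by blast+
    then show "D = (pt \<alpha> (inv_m l * x), pt \<beta> (l * y))"
      using pt_eqI[OF le_q(3)] pt_eqI[OF le_q(4)] *(1,2) unfolding D_eq by blast
  qed
  finally show ?thesis .
qed

lemma T_eq: "T = {(pt \<alpha> x, pt \<beta> y) | x y. True}"
  using le_q by (auto simp: carrier_Res)

text \<open>\<open>BijGroup\<close> consists of extensional maps; with this, agreement on the points
  of \<open>T\<close> is equality of functions.\<close>

lemma act_extensional: "act Y \<in> extensional T"
  by (simp add: resid_act_def)

lemma T_ext:
  assumes "f \<in> extensional T" "g \<in> extensional T"
    "\<And>x y. f (pt \<alpha> x, pt \<beta> y) = g (pt \<alpha> x, pt \<beta> y)"
  shows "f = g"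
  using assms by (intro extensionalityI[of f T g]) (auto simp: T_eq)

lemma pt_in_T: "(pt \<alpha> x, pt \<beta> y) \<in> T"
  using le_q by (simp add: pt_in_Res)

lemma act_diag_coset_mult:
  assumes "unit l" "unit l'"
  shows "act (diag_coset (l * l')) = compose T (act (diag_coset l)) (act (diag_coset l'))"
proof (rule T_ext)
  fix x y
  have "[inv_m (l * l') * x = inv_m l * (inv_m l' * x)] (mod m)"
  proof (rule cancel_unit)
    show "unit (l * l')" using assms by simp
    then have e: "[(l * l') * inv_m (l * l') = 1] (mod m)" by (rule inv_m_right)
    show "[l * l' * (inv_m (l * l') * x) = l * l' * (inv_m l * (inv_m l' * x))] (mod m)"
      by (rule cong_combination3[OF e inv_m_right[OF assms(1)] inv_m_right[OF assms(2)], where c = x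
            and c' = "- x * l' * inv_m l'" and c'' = "- x"]) (simp add: algebra_simps)
  qed
  then have "pt \<alpha> (inv_m (l * l') * x) = pt \<alpha> (inv_m l * (inv_m l' * x))"
    using le_q by (simp add: pt_eq_iff cong_m_imp_pr)
  then show "act (diag_coset (l * l')) (pt \<alpha> x, pt \<beta> y) = compose T (act (diag_coset l)) (act (diag_coset l')) (pt \<alpha> x, pt \<beta> y)"
    using assms by (simp add: act_diag_coset compose_eq[OF pt_in_T] mult.assoc)
qed (simp_all add: act_extensional)

text \<open>The second coordinate of the image of (1, 1) is l modulo p^r. Conversely, inverses taken
  modulo p^q are also inverses modulo p^r, where they depend only on l modulo p^r.\<close>

lemma act_diag_coset_eq_iff:
  assumes "unit l" "unit l'"
  shows "act (diag_coset l) = act (diag_coset l') \<longleftrightarrow> [l = l'] (mod pr)"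
proof
  assume "act (diag_coset l) = act (diag_coset l')"
  then have "act (diag_coset l) (pt \<alpha> 1, pt \<beta> 1) = act (diag_coset l') (pt \<alpha> 1, pt \<beta> 1)" by simp
  then show "[l = l'] (mod pr)" using assms le_q by (simp add: act_diag_coset pt_eq_iff)
next
  assume l: "[l = l'] (mod pr)"
  have inv: "[inv_m l = inv_m l'] (mod pr)"
    by (rule cong_combination3[OF inv_m_right_pr[OF assms(1)] inv_m_right_pr[OF assms(2)] l,
          where c = "inv_m l'" and c' = "- inv_m l" and c'' = "- inv_m l * inv_m l'"])
      (simp add: algebra_simps)
  show "act (diag_coset l) = act (diag_coset l')"
    using assms l inv le_q
    by (intro T_ext) (simp_all add: act_extensional act_diag_coset pt_eq_iff cong_scalar_right)
qed

lemma act_diag_coset_1: "act (diag_coset 1) = (\<lambda>z\<in>T. z)"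
  using m_gt_1
  by (intro T_ext) (simp_all add: act_extensional act_diag_coset restrict_apply'[OF pt_in_T] del: restrict_apply)

lemma act_diag_coset_Bij:
  assumes "unit l"
  shows "act (diag_coset l) \<in> Bij T"
proof -
  have "act (diag_coset k) \<in> T \<rightarrow> T" if "unit k" for k
    using act_diag_coset[OF that] le_q by (auto simp: carrier_Res)
  moreover have "compose T (act (diag_coset k)) (act (diag_coset k')) = (\<lambda>z\<in>T. z)"
    if "unit k" "unit k'" "[k * k' = 1] (mod m)" for k k'
  proof -
    have "diag_coset (k * k') = diag_coset 1" using that by (simp add: diag_coset_eq_iff)
    then show ?thesis using act_diag_coset_mult[OF that(1,2)] act_diag_coset_1 by simp
  qed
  moreover have "unit (inv_m l)" "[l * inv_m l = 1] (mod m)" "[inv_m l * l = 1] (mod m)"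
    using unit_inv_m[OF assms] inv_m_right[OF assms] by (simp_all add: mult.commute)
  ultimately have fn: "act (diag_coset l) \<in> T \<rightarrow> T" "act (diag_coset (inv_m l)) \<in> T \<rightarrow> T"
    and "compose T (act (diag_coset l)) (act (diag_coset (inv_m l))) = (\<lambda>z\<in>T. z)"
    "compose T (act (diag_coset (inv_m l))) (act (diag_coset l)) = (\<lambda>z\<in>T. z)"
    using assms by blast+
  then have "act (diag_coset (inv_m l)) (act (diag_coset l) z) = z" "act (diag_coset l) (act (diag_coset (inv_m l)) z) = z"
    if "z \<in> T" for z
    using compose_eq[OF that, of "act (diag_coset l)" "act (diag_coset (inv_m l))"]
      compose_eq[OF that, of "act (diag_coset (inv_m l))" "act (diag_coset l)"] restrict_apply'[OF that, of "\<lambda>z. z"]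
    by simp_all
  then have "bij_betw (act (diag_coset l)) T T"
    using fn by (intro bij_betwI[where g = "act (diag_coset (inv_m l))"])
  then show ?thesis by (simp add: Bij_def act_extensional)
qed

lemma group_action_Q: "group_action Q T act"
  unfolding group_action_def group_hom_def group_hom_axioms_def
proof (intro conjI group_Q group_BijGroup homI)
  fix K assume "K \<in> carrier Q"
  then show "act K \<in> carrier (BijGroup T)"
    using act_diag_coset_Bij by (auto simp: carrier_Q BijGroup_def)
next
  fix K K' assume "K \<in> carrier Q" "K' \<in> carrier Q"
  then obtain l l' where "unit l" "unit l'" "K = diag_coset l" "K' = diag_coset l'" unfolding carrier_Q by blast
  then show "act (K \<otimes>\<^bsub>Q\<^esub> K') = act K \<otimes>\<^bsub>BijGroup T\<^esub> act K'"
    using act_diag_coset_Bij by (simp add: diag_coset_mult act_diag_coset_mult BijGroup_def del: mult_FactGroup)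
qed

lemma act_W_coset:
  assumes "v \<in> I \<alpha>" "u \<in> I \<beta>" "l \<in> Units R"
  shows "act (W #>\<^bsub>G\<^esub> M v u l) (pt \<alpha> x, pt \<beta> y) = (pt \<alpha> (inv_m l * x), pt \<beta> (l * y))"
  using assms le_q by (simp add: W_coset act_diag_coset I_eq Units_R)

section \<open>The residual pairing\<close>

abbreviation e where "e \<equiv> resid_pairing p r q \<chi>"

text \<open>As p^\<alpha> p^\<beta> = p^(q-r), the product c s is p^(q-r) times a number congruent
  to x y modulo p^r, which is all that \<open>E\<close> sees. This gives both well-definedness of
  the pairing and its formula in coordinates.\<close>

lemma chi_pt:
  assumes "c \<in> pt \<alpha> x" "s \<in> pt \<beta> y"
  shows "chi (c * s) = E (x * y)"
proof -
  have "[c = pa * x] (mod pa * pr)" "[s = pb * y] (mod pb * pr)"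
    using assms le_q by (simp_all add: pt_eq power_add)
  then obtain t t' where "c - pa * x = pa * pr * t" "s - pb * y = pb * pr * t'"
    by (auto simp: cong_iff_dvd_diff elim!: dvdE)
  then have c: "c = pa * (x + pr * t)" and s: "s = pb * (y + pr * t')"
    by (simp_all add: algebra_simps)
  have "chi (c * s) = E ((x + pr * t) * (y + pr * t'))"
    unfolding E_def c s sum[symmetric] power_add by (simp add: ac_simps)
  also have "\<dots> = E (x * y)"
    unfolding E_eq_iff by (simp add: cong_iff_dvd_diff algebra_simps)
  finally show ?thesis .
qed

lemma e_pt: "e (pt \<alpha> x) (pt \<beta> y) = E (x * y)"
  unfolding resid_pairing_def
  using chi_pt pt_self[OF le_q(3), of x] pt_self[OF le_q(4), of y] by (intro the_equality) auto

lemma e_eq: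
  assumes "C \<in> carrier A" "V \<in> carrier B" "c \<in> C" "s \<in> V"
  shows "e C V = chi (c * s)"
  using assms le_q chi_pt by (auto simp: carrier_Res e_pt)

text \<open>In coordinates the pairing is E(x y). Every homomorphism is of this shape by
  \<open>hom_Res_mu\<close>, and its coordinate is recovered modulo p^r from the value at the
  generator.\<close>

lemma e_perfect: "perfect_pairing A B (mu (p ^ r)) e"
proof -
  have mu: "E t \<in> carrier (mu (p ^ r))" "x \<otimes>\<^bsub>mu (p ^ r)\<^esub> y = x * y" for t x y
    by (simp_all add: mu_def complex_mult_on_def E_root)
  show ?thesis
    unfolding perfect_pairing_def
  proof (intro conjI ballI)
    fix C assume "C \<in> carrier A"
    then show "e C \<in> hom B (mu (p ^ r))"
      using le_q by (auto intro!: homI simp: carrier_Res e_pt mu pt_mult distrib_left E_add)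
  next
    fix V assume "V \<in> carrier B"
    then show "(\<lambda>C. e C V) \<in> hom A (mu (p ^ r))"
      using le_q by (auto intro!: homI simp: carrier_Res e_pt mu pt_mult distrib_right E_add)
  next
    fix \<psi> assume "\<psi> \<in> hom B (mu (p ^ r))"
    then obtain x where x: "\<And>y. \<psi> (pt \<beta> y) = E (x * y)" using hom_Res_mu[OF le_q(4)] by blast
    show "\<exists>!C. C \<in> carrier A \<and> (\<forall>V\<in>carrier B. \<psi> V = e C V)"
    proof (rule ex1I)
      show "pt \<alpha> x \<in> carrier A \<and> (\<forall>V\<in>carrier B. \<psi> V = e (pt \<alpha> x) V)"
        using le_q x by (auto simp: carrier_Res e_pt)
      fix C assume C: "C \<in> carrier A \<and> (\<forall>V\<in>carrier B. \<psi> V = e C V)"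
      then obtain x' where x': "C = pt \<alpha> x'" using le_q by (auto simp: carrier_Res)
      have "\<psi> (pt \<beta> 1) = e C (pt \<beta> 1)" using C pt_in_Res[OF le_q(4)] by blast
      then show "C = pt \<alpha> x" using le_q by (simp add: x' e_pt x E_eq_iff pt_eq_iff cong_sym_eq)
    qed
  next
    fix \<psi> assume "\<psi> \<in> hom A (mu (p ^ r))"
    then obtain y where y: "\<And>x. \<psi> (pt \<alpha> x) = E (y * x)" using hom_Res_mu[OF le_q(3)] by blast
    show "\<exists>!V. V \<in> carrier B \<and> (\<forall>C\<in>carrier A. \<psi> C = e C V)"
    proof (rule ex1I)
      show "pt \<beta> y \<in> carrier B \<and> (\<forall>C\<in>carrier A. \<psi> C = e C (pt \<beta> y))"
        using le_q y by (auto simp: carrier_Res e_pt mult.commute)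
      fix V assume V: "V \<in> carrier B \<and> (\<forall>C\<in>carrier A. \<psi> C = e C V)"
      then obtain y' where y': "V = pt \<beta> y'" using le_q by (auto simp: carrier_Res)
      have "\<psi> (pt \<alpha> 1) = e (pt \<alpha> 1) V" using V pt_in_Res[OF le_q(3)] by blast
      then show "V = pt \<beta> y" using le_q by (simp add: y' e_pt y E_eq_iff pt_eq_iff cong_sym_eq)
    qed
  qed
qed

lemma e_act:
  assumes "Y \<in> carrier Q" "C \<in> carrier A" "V \<in> carrier B"
  shows "case act Y (C, V) of (C', V') \<Rightarrow> e C' V' = e C V"
proof -
  obtain l x y where l: "unit l" "Y = diag_coset l" "C = pt \<alpha> x" "V = pt \<beta> y"
    using assms le_q by (auto simp: carrier_Q carrier_Res)
  have "[inv_m l * x * (l * y) = x * y] (mod pr)"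
    by (rule cong_combination1[OF inv_m_right_pr[OF l(1)], where c = "x * y"]) (simp add: algebra_simps)
  then show ?thesis using l by (simp add: act_diag_coset e_pt E_eq_iff)
qed

section \<open>The isomorphism with the unit group and the effective action\<close>

definition label :: "(complex mat \<times> complex mat) set set \<Rightarrow> int" where
  "label Y = (THE l. l \<in> Units R \<and> Y = diag_coset l)"

lemma label_diag_coset:
  assumes "unit l"
  shows "label (diag_coset l) = l mod m"
  unfolding label_def
proof (rule the_equality)
  have "[l = l mod m] (mod m)" by (simp add: cong_def)
  then show "l mod m \<in> Units R \<and> diag_coset l = diag_coset (l mod m)"
    using assms by (simp add: Units_R unit_mod diag_coset_eq_iff)
next
  fix k assume k: "k \<in> Units R \<and> diag_coset l = diag_coset k"
  then have "[l = k] (mod m)" using assms diag_coset_eq_iff[of l k] by (simp add: Units_R)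
  then show "k = l mod m" using k by (simp add: Units_R cong_def)
qed

lemma label_iso: "label \<in> iso Q (units_of R)"
proof (rule isoI)
  show "label \<in> hom Q (units_of R)"
  proof (rule homI)
    fix Y assume "Y \<in> carrier Q"
    then obtain l where "unit l" "Y = diag_coset l" unfolding carrier_Q by blast
    then show "label Y \<in> carrier (units_of R)"
      by (simp add: label_diag_coset units_of_def Units_R unit_mod)
  next
    fix Y Y' assume "Y \<in> carrier Q" "Y' \<in> carrier Q"
    then obtain l l' where l: "unit l" "unit l'" and Y: "Y = diag_coset l" "Y' = diag_coset l'"
      unfolding carrier_Q by blast
    then have "label (Y \<otimes>\<^bsub>Q\<^esub> Y') = (l * l') mod m"
      by (simp add: diag_coset_mult label_diag_coset del: mult_FactGroup)
    moreover have "label Y \<otimes>\<^bsub>units_of R\<^esub> label Y' = (l * l') mod m"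
      using l by (simp add: Y label_diag_coset units_of_def residue_ring_def mod_mult_eq)
    ultimately show "label (Y \<otimes>\<^bsub>Q\<^esub> Y') = label Y \<otimes>\<^bsub>units_of R\<^esub> label Y'"
      by simp
  qed
  show "bij_betw label (carrier Q) (carrier (units_of R))"
  proof (rule bij_betw_imageI)
    show "inj_on label (carrier Q)"
    proof (rule inj_onI)
      fix Y Y' assume "Y \<in> carrier Q" "Y' \<in> carrier Q" and eq: "label Y = label Y'"
      then obtain l l' where "unit l" "unit l'" "Y = diag_coset l" "Y' = diag_coset l'" unfolding carrier_Q by blast
      then show "Y = Y'" using eq by (simp only: label_diag_coset diag_coset_eq_iff cong_def)
    qed
    show "label ` carrier Q = carrier (units_of R)"
    proof (intro subset_antisym subsetI)
      fix l assume "l \<in> carrier (units_of R)"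
      then have "unit l" "l = l mod m" by (simp_all add: units_of_def Units_R)
      then have "l = label (diag_coset l)" "diag_coset l \<in> carrier Q" by (simp_all add: label_diag_coset diag_coset_in_Q)
      then show "l \<in> label ` carrier Q" by blast
    next
      fix x assume "x \<in> label ` carrier Q"
      then obtain l where "unit l" "x = label (diag_coset l)" unfolding carrier_Q by blast
      then show "x \<in> carrier (units_of R)" by (simp add: label_diag_coset units_of_def Units_R unit_mod)
    qed
  qed
qed

lemma label_W_coset:
  assumes "v \<in> I \<alpha>" "u \<in> I \<beta>" "l \<in> Units R"
  shows "label (W #>\<^bsub>G\<^esub> M v u l) = l"
  using assms le_q by (simp add: W_coset label_diag_coset I_eq Units_R)

text \<open>Trivial action means \<lambda> = 1 modulo p^r, and every integer 1 + p^r t is a unit, so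
  no further condition remains.\<close>

lemma label_kernel:
  "label ` kernel Q (BijGroup T) act = {(1 + pr * t) mod m | t. t \<in> carrier R}"
proof -
  have "kernel Q (BijGroup T) act = {diag_coset l | l. unit l \<and> [l = 1] (mod pr)}"
    using act_diag_coset_eq_iff[of _ 1] by (auto simp: kernel_def carrier_Q BijGroup_def act_diag_coset_1)
  then have "label ` kernel Q (BijGroup T) act = {l mod m | l. unit l \<and> [l = 1] (mod pr)}"
    using label_diag_coset by (auto simp: image_iff) (metis label_diag_coset)
  also have "\<dots> = {(1 + pr * t) mod m | t. t \<in> carrier R}"
  proof (intro subset_antisym subsetI)
    fix x assume "x \<in> {l mod m | l. unit l \<and> [l = 1] (mod pr)}"
    then obtain l where l: "x = l mod m" "[l = 1] (mod pr)" by blast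
    then obtain t where t: "l - 1 = pr * t" by (auto simp: cong_iff_dvd_diff elim: dvdE)
    have "l = 1 + pr * t" using t by simp
    then have "x = (1 + pr * (t mod m)) mod m"
      using l(1) by (metis mod_add_right_eq mod_mult_right_eq)
    moreover have "t mod m \<in> carrier R" by (simp add: carrier_R)
    ultimately show "x \<in> {(1 + pr * t) mod m | t. t \<in> carrier R}" by blast
  next
    fix x assume "x \<in> {(1 + pr * t) mod m | t. t \<in> carrier R}"
    then obtain t where "x = (1 + pr * t) mod m" by blast
    moreover have "unit (1 + pr * t)" "[1 + pr * t = 1] (mod pr)"
      by (simp_all add: unit_1_pr cong_iff_dvd_diff)
    ultimately show "x \<in> {l mod m | l. unit l \<and> [l = 1] (mod pr)}" by blast
  qed
  finally show ?thesis .
qed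

lemma residues_r: "residues pr"
  using pr_gt_1 by unfold_locales

lemma Units_Rr: "carrier (units_of (Rq p r)) = {x \<in> {0..<pr}. unit x}"
proof -
  interpret residues pr "Rq p r" by (rule residues_r) simp
  have "\<not> unit 0" using p_gt_1 by simp
  then show ?thesis
    using r_pos unfolding units_of_carrier res_units_eq by (auto simp: le_less)
qed

text \<open>A least residue modulo p^r is itself used as a label, which lifts it to a unit of R_q.
  This lift is multiplicative only modulo p^r, but by \<open>act_diag_coset_eq_iff\<close> the
  action depends on nothing more.\<close>

lemma effective_action:
  shows "group_action (units_of (Rq p r)) T (\<lambda>l. act (diag_coset l))"
    and "inj_on (\<lambda>l. act (diag_coset l)) (carrier (units_of (Rq p r)))"
    and "\<forall>Y\<in>carrier Q. act Y = act (diag_coset (label Y mod pr))"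
proof -
  interpret residues pr "Rq p r" by (rule residues_r) simp
  have unit_mod_pr: "unit (l mod pr) \<longleftrightarrow> unit l" for l
    using p_dvd_pr by (intro unit_cong) (simp add: cong_def mod_mod_cancel)
  show "group_action (units_of (Rq p r)) T (\<lambda>l. act (diag_coset l))"
    unfolding group_action_def group_hom_def group_hom_axioms_def
  proof (intro conjI units_group group_BijGroup homI)
    fix l assume "l \<in> carrier (units_of (Rq p r))"
    then show "act (diag_coset l) \<in> carrier (BijGroup T)"
      using act_diag_coset_Bij by (simp add: Units_Rr BijGroup_def)
  next
    fix l l' assume "l \<in> carrier (units_of (Rq p r))" "l' \<in> carrier (units_of (Rq p r))"
    then have l: "unit l" "unit l'" by (simp_all add: Units_Rr)
    have "act (diag_coset (l \<otimes>\<^bsub>units_of (Rq p r)\<^esub> l')) = act (diag_coset (l * l' mod pr))"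
      by (simp add: units_of_def residue_ring_def)
    also have "\<dots> = act (diag_coset (l * l'))"
      using l by (subst act_diag_coset_eq_iff) (simp_all add: unit_mod_pr cong_def)
    finally show "act (diag_coset (l \<otimes>\<^bsub>units_of (Rq p r)\<^esub> l')) = act (diag_coset l) \<otimes>\<^bsub>BijGroup T\<^esub> act (diag_coset l')"
      using l act_diag_coset_Bij by (simp add: act_diag_coset_mult BijGroup_def)
  qed
  show "inj_on (\<lambda>l. act (diag_coset l)) (carrier (units_of (Rq p r)))"
    by (auto intro!: inj_onI simp: Units_Rr act_diag_coset_eq_iff cong_def)
  show "\<forall>Y\<in>carrier Q. act Y = act (diag_coset (label Y mod pr))"
  proof
    fix Y assume "Y \<in> carrier Q"
    then obtain l where l: "unit l" "Y = diag_coset l" unfolding carrier_Q by blast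
    then show "act Y = act (diag_coset (label Y mod pr))"
      using pr_dvd_m by (simp add: label_diag_coset act_diag_coset_eq_iff unit_mod_pr cong_def mod_mod_cancel)
  qed
qed

end

theorem theorem5p3:
  fixes p r q \<alpha> \<beta> :: nat and \<chi> :: "int \<Rightarrow> complex"
  assumes "prime p" "odd p" "1 \<le> r" "r < q" "\<alpha> + \<beta> = q - r"
    and "faithful_character p r q \<chi>"
  shows
    "let G = proj_aut p r q \<chi>;
         M = M_elt p r q \<chi>;
         X = X_elt p r q \<chi>;
         R = Rq p q;
         W = window p r q \<chi> \<alpha> \<beta>;
         N = {M v u l | v u l. v \<in> ppow_ideal p q \<alpha> \<and> u \<in> ppow_ideal p q \<beta> \<and> l \<in> Units R};
         \<iota> = modular_inverse (int p ^ q);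
         A = resid p r q \<alpha>; B = resid p r q \<beta>;
         a = resid_pt p r q \<alpha>; b = resid_pt p r q \<beta>;
         e = resid_pairing p r q \<chi>;
         act = resid_act p r q \<chi> \<alpha> \<beta>;
         Q = G\<lparr>carrier := N\<rparr> Mod W
     in normalizer G W = N \<and>
        card N = p ^ (q + r) * totient (p ^ q) \<and>
        (\<forall>u\<in>carrier R. \<forall>v\<in>carrier R. \<forall>l\<in>Units R. \<forall>c\<in>carrier R. \<forall>s\<in>carrier R.
           let \<Delta> = l - int p ^ r * u * v;
               \<A> = int p ^ r * (u * c - l * v * s);
               \<B> = l ^ 2 * s - int p ^ r * u ^ 2 * c;
               \<C> = int p ^ r * (c - int p ^ r * v ^ 2 * s);
               Z = 1\<^sub>m 2 + \<iota> \<Delta> \<cdot>\<^sub>m mat2 \<A> \<B> \<C> (- \<A>);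
               inverse_pair = (\<lambda>Y. Y \<in> carrier_mat 2 2 \<and>
                  mat_cong p r q (M_mat p r v u l * Y) (1\<^sub>m 2) \<and>
                  mat_cong p r q (Y * M_mat p r v u l) (1\<^sub>m 2))
           in (\<exists>Y. inverse_pair Y) \<and>
              (\<forall>Y. inverse_pair Y \<longrightarrow>
                 mat_cong p r q (M_mat p r v u l * X_mat p r c s * Y) Z) \<and>
              M v u l \<otimes>\<^bsub>G\<^esub> X c s \<otimes>\<^bsub>G\<^esub> inv\<^bsub>G\<^esub> (M v u l) = proj_elt p r q \<chi> Z) \<and>
        (\<forall>v\<in>ppow_ideal p q \<alpha>. \<forall>u\<in>ppow_ideal p q \<beta>. \<forall>l\<in>Units R.
         \<forall>c\<in>ppow_ideal p q \<alpha>. \<forall>s\<in>ppow_ideal p q \<beta>.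
           M v u l \<otimes>\<^bsub>G\<^esub> X c s \<otimes>\<^bsub>G\<^esub> inv\<^bsub>G\<^esub> (M v u l) = X (\<iota> l * c) (l * s)) \<and>
        (\<forall>\<alpha>' \<beta>'. \<alpha>' + \<beta>' = q - r \<and> (\<alpha>', \<beta>') \<noteq> (\<alpha>, \<beta>) \<longrightarrow>
           \<not> (\<exists>g\<in>carrier G. g <#\<^bsub>G\<^esub> W #>\<^bsub>G\<^esub> inv\<^bsub>G\<^esub> g = window p r q \<chi> \<alpha>' \<beta>')) \<and>
        W \<lhd> G\<lparr>carrier := N\<rparr> \<and>
        (\<forall>C\<in>carrier A. \<forall>S\<in>carrier B. \<forall>c\<in>C. \<forall>s\<in>S. e C S = chi1 p r q \<chi> (c * s)) \<and>
        perfect_pairing A B (mu (p ^ r)) e \<and>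
        group_action Q (carrier A \<times> carrier B) act \<and>
        (\<forall>v\<in>ppow_ideal p q \<alpha>. \<forall>u\<in>ppow_ideal p q \<beta>. \<forall>l\<in>Units R.
         \<forall>x\<in>carrier (Rq p r). \<forall>y\<in>carrier (Rq p r).
           act (W #>\<^bsub>G\<^esub> M v u l) (a x, b y) = (a (\<iota> l * x), b (l * y))) \<and>
        (\<forall>K\<in>carrier Q. \<forall>C\<in>carrier A. \<forall>S\<in>carrier B.
           case act K (C, S) of (C', S') \<Rightarrow> e C' S' = e C S) \<and>
        (\<exists>\<theta> \<psi>. \<theta> \<in> iso Q (units_of R) \<and>
           (\<forall>v\<in>ppow_ideal p q \<alpha>. \<forall>u\<in>ppow_ideal p q \<beta>. \<forall>l\<in>Units R.
              \<theta> (W #>\<^bsub>G\<^esub> M v u l) = l) \<and>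
           \<theta> ` kernel Q (BijGroup (carrier A \<times> carrier B)) act
             = {(1 + int p ^ r * t) mod int p ^ q | t. t \<in> carrier R} \<and>
           group_action (units_of (Rq p r)) (carrier A \<times> carrier B) \<psi> \<and>
           inj_on \<psi> (carrier (units_of (Rq p r))) \<and>
           (\<forall>K\<in>carrier Q. act K = \<psi> (\<theta> K mod int p ^ r)))"
proof -
  interpret maximal_polarization p r q \<chi> \<alpha> \<beta>
    using assms by unfold_locales
  \<comment> \<open>Kept with \<open>conj_Z\<close> folded; unfolding it at the very end yields the
    literal matrix Z of the statement.\<close>
  have conj_formula: "(\<exists>Y. Y \<in> carrier_mat 2 2 \<and> mat_cong p r q (M_mat p r v u l * Y) (1\<^sub>m 2) \<and>
        mat_cong p r q (Y * M_mat p r v u l) (1\<^sub>m 2)) \<and>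
      (\<forall>Y. Y \<in> carrier_mat 2 2 \<and> mat_cong p r q (M_mat p r v u l * Y) (1\<^sub>m 2) \<and>
        mat_cong p r q (Y * M_mat p r v u l) (1\<^sub>m 2) \<longrightarrow>
        mat_cong p r q (M_mat p r v u l * X_mat p r c s * Y) (conj_Z u v l c s)) \<and>
      M v u l \<otimes>\<^bsub>G\<^esub> X c s \<otimes>\<^bsub>G\<^esub> inv\<^bsub>G\<^esub> (M v u l) = proj_elt p r q \<chi> (conj_Z u v l c s)"
    if "l \<in> Units R" for u v l c s
  proof -
    have "unit l" using that by (simp add: Units_R)
    then show ?thesis using inverse_mat_ex conj_mat_cong conj_proj_elt by blast
  qed
  have N_conj': "M v u l \<otimes>\<^bsub>G\<^esub> X c s \<otimes>\<^bsub>G\<^esub> inv\<^bsub>G\<^esub> (M v u l) = X (inv_m l * c) (l * s)"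
    if "v \<in> I \<alpha>" "u \<in> I \<beta>" "l \<in> Units R" "c \<in> I \<alpha>" "s \<in> I \<beta>" for v u l c s
    using that le_q by (intro N_conj) (simp_all add: I_eq Units_R)
  show ?thesis
    unfolding Let_def
  proof (intro conjI)
    show "normalizer G W = N" by (rule normalizer_W)
    show "card N = p ^ (q + r) * totient n" by (rule card_N)
    show "W \<lhd> G\<lparr>carrier := N\<rparr>" by (rule W_normal)
    show "perfect_pairing A B (mu (p ^ r)) e" by (rule e_perfect)
    show "group_action Q T act" by (rule group_action_Q)
    show "\<exists>\<theta> \<psi>. \<theta> \<in> iso Q (units_of R) \<and>
       (\<forall>v\<in>I \<alpha>. \<forall>u\<in>I \<beta>. \<forall>l\<in>Units R. \<theta> (W #>\<^bsub>G\<^esub> M v u l) = l) \<and>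
       \<theta> ` kernel Q (BijGroup T) act = {(1 + pr * t) mod m | t. t \<in> carrier R} \<and>
       group_action (units_of (Rq p r)) T \<psi> \<and>
       inj_on \<psi> (carrier (units_of (Rq p r))) \<and>
       (\<forall>K\<in>carrier Q. act K = \<psi> (\<theta> K mod pr))"
      using label_iso label_W_coset label_kernel effective_action
      by (intro exI[of _ label] exI[of _ "\<lambda>l. act (diag_coset l)"] conjI ballI) blast+
    show "\<forall>C\<in>carrier A. \<forall>V\<in>carrier B. \<forall>c\<in>C. \<forall>s\<in>V. e C V = chi (c * s)"
      using e_eq by blast
    show "\<forall>\<alpha>' \<beta>'. \<alpha>' + \<beta>' = q - r \<and> (\<alpha>', \<beta>') \<noteq> (\<alpha>, \<beta>) \<longrightarrow>
        \<not> (\<exists>g\<in>carrier G. g <#\<^bsub>G\<^esub> W #>\<^bsub>G\<^esub> inv\<^bsub>G\<^esub> g = window p r q \<chi> \<alpha>' \<beta>')"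
      using windows_not_conj by blast
    show "\<forall>v\<in>I \<alpha>. \<forall>u\<in>I \<beta>. \<forall>l\<in>Units R. \<forall>c\<in>I \<alpha>. \<forall>s\<in>I \<beta>.
        M v u l \<otimes>\<^bsub>G\<^esub> X c s \<otimes>\<^bsub>G\<^esub> inv\<^bsub>G\<^esub> (M v u l) = X (inv_m l * c) (l * s)"
      by (intro ballI) (rule N_conj')
    show "\<forall>v\<in>I \<alpha>. \<forall>u\<in>I \<beta>. \<forall>l\<in>Units R. \<forall>x\<in>carrier (Rq p r). \<forall>y\<in>carrier (Rq p r).
        act (W #>\<^bsub>G\<^esub> M v u l) (pt \<alpha> x, pt \<beta> y) = (pt \<alpha> (inv_m l * x), pt \<beta> (l * y))"
      by (intro ballI) (rule act_W_coset)
    show "\<forall>Y\<in>carrier Q. \<forall>C\<in>carrier A. \<forall>V\<in>carrier B.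
        case act Y (C, V) of (C', V') \<Rightarrow> e C' V' = e C V"
      by (intro ballI) (rule e_act)
  qed (intro ballI, rule conj_formula[unfolded conj_Z_def conj_defs])
qed

end
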